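(* There is a streaming algorithm using $\mathrm{O}(\sqrt{N\log N})$ space and $\mathrm{O}(1)$ processing time per letter which performs one pass over the input stream containing $\mathrm{XML}(\mathrm{FCNS}(t))$, for any tree $t$ with $N$ nodes, and two passes over an output stream onto which it outputs $\mathrm{XML}(t)$.
   Context: Trees: finite rooted ordered (unranked) trees whose nodes are labeled by letters of a finite alphabet $\Sigma$. For each label $a$ there is an opening tag $a$ and a closing tag $\bar a$; $\mathrm{XML}(t)$ is the sequence of tags of a depth-first left-to-right traversal (opening tag on entering a node, closing tag on leaving it). The First-Child-Next-Sibling encoding $\mathrm{FCNS}(t)$ is the tree on the same node set, with the same root, where the left child of $v$ is its first child in $t$ (if any) and the right child of $v$ is its next sibling in $t$ (if any); each node is labeled $a_L$ if it is a left child (the root by convention) and $a_R$ if it is a right child, $a$ being its label in $t$; $\mathrm{XML}(\mathrm{FCNS}(t))$ is its XML sequence with annotated tags (left child visited before right child). Streaming model: streams are accessed sequentially; the output stream is a read/write stream on which, in each pass, the algorithm can write a letter in the current cell or skip it; space is the size of internal memory (in letters and bits); processing time per letter is the maximal running time between two consecutive read/write operations; arithmetic on integers of size $\mathrm{O}(N)$ takes constant time. *)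

theory Defs
  imports Complex_Main "HOL-Library.Tree" "HOL-Library.Log_Nat" "HOL-Library.Landau_Symbols"
begin

section \<open>Unranked trees, XML sequences and the FCNS encoding\<close>

datatype 'a utree = UNode 'a "'a utree list"

fun num_nodes :: "'a utree \<Rightarrow> nat" where
  "num_nodes (UNode a ts) = Suc (sum_list (map num_nodes ts))"

datatype 'l tag = Opening 'l | Closing 'l

fun xml :: "'a utree \<Rightarrow> 'a tag list" where
  "xml (UNode a ts) = Opening a # concat (map xml ts) @ [Closing a]"

text \<open>Binary trees are those of \<^theory>\<open>HOL-Library.Tree\<close>; a missing child is \<^const>\<open>Leaf\<close>
  and contributes no tags.\<close>

fun xml_bin :: "'b tree \<Rightarrow> 'b tag list" where
  "xml_bin Leaf = []"
| "xml_bin (Node l b r) = Opening b # xml_bin l @ xml_bin r @ [Closing b]"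

datatype side = LeftChild | RightChild

text \<open>\<open>fcns_from s (v # vs)\<close> is the binary tree rooted at \<open>v\<close>, where \<open>vs\<close> lists the following
  siblings of \<open>v\<close> and \<open>s\<close> tells which child \<open>v\<close> itself is. Its left child is the first child of
  \<open>v\<close>, its right child is the next sibling of \<open>v\<close>. The pair \<open>(a, LeftChild)\<close> stands for the
  annotated label $a_L$, and \<open>(a, RightChild)\<close> for $a_R$.\<close>

fun fcns_from :: "side \<Rightarrow> 'a utree list \<Rightarrow> ('a \<times> side) tree" where
  "fcns_from s [] = Leaf"
| "fcns_from s (UNode a cs # vs) = Node (fcns_from LeftChild cs) (a, s) (fcns_from RightChild vs)"

definition fcns :: "'a utree \<Rightarrow> ('a \<times> side) tree" where
  "fcns t = fcns_from LeftChild [t]"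


section \<open>Streaming algorithms\<close>

text \<open>A streaming algorithm is a program for a random access machine with a read-only input stream
  over the alphabet \<open>'i\<close> and a read/write output stream over the alphabet \<open>'o\<close>. The internal
  memory consists of two arrays, one whose cells hold natural numbers (initially 0), and one whose
  cells hold letters (initially \<open>Blank\<close>). One program serves inputs of all lengths, and it is not
  told the length of its input.

  \<open>Dir n\<close> addresses the cell number \<open>n\<close> of the array in question; \<open>Ind n\<close> addresses the cell whose
  number is stored in the number cell \<open>n\<close>.\<close>

datatype ('i, 'o) letter = Blank | InLetter 'i | OutLetter 'o

datatype addr = Dir nat | Ind nat

datatype arith_op = Add | Sub | Mul | Div | Mod

fun arith :: "arith_op \<Rightarrow> nat \<Rightarrow> nat \<Rightarrow> nat" where
  "arith Add m n = m + n"
| "arith Sub m n = m - n"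
| "arith Mul m n = m * n"
| "arith Div m n = m div n"
| "arith Mod m n = m mod n"

text \<open>The last argument of each jump, and of \<open>ReadIn\<close> (used at the end of the input), is the target
  line. Both alphabets being finite, the functions and predicates on letters are finite tables.\<close>

datatype ('i, 'o) instr =
    SetConst addr nat
  | Arith arith_op addr addr addr
  | Jump nat
  | JumpEq addr addr nat
  | JumpLess addr addr nat
  | MapLetter "('i, 'o) letter \<Rightarrow> ('i, 'o) letter" addr addr
  | JumpLetter "('i, 'o) letter \<Rightarrow> bool" addr nat
  | ReadIn addr nat
  | RewindIn
  | ReadOut addr
  | WriteOut "('i, 'o) letter \<Rightarrow> 'o" addr
  | SkipOut
  | RewindOut

type_synonym ('i, 'o) program = "('i, 'o) instr list"

text \<open>\<open>num_ext\<close> and \<open>let_ext\<close> are the lengths of the initial segments of the two arrays that the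
  program has written to so far. Unwritten cells of the output stream contain \<open>None\<close>.\<close>

record ('i, 'o) config =
  pc :: nat
  nums :: "nat \<Rightarrow> nat"
  num_ext :: nat
  lets :: "nat \<Rightarrow> ('i, 'o) letter"
  let_ext :: nat
  in_pos :: nat
  in_passes :: nat
  out_stream :: "nat \<Rightarrow> 'o option"
  out_pos :: nat
  out_passes :: nat

definition initial :: "('i, 'o) config" where
  "initial = \<lparr>pc = 0, nums = (\<lambda>_. 0), num_ext = 0, lets = (\<lambda>_. Blank), let_ext = 0,
     in_pos = 0, in_passes = 1, out_stream = (\<lambda>_. None), out_pos = 0, out_passes = 1\<rparr>"

fun loc :: "('i, 'o) config \<Rightarrow> addr \<Rightarrow> nat" where
  "loc c (Dir n) = n"
| "loc c (Ind n) = nums c n"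

definition get_num :: "('i, 'o) config \<Rightarrow> addr \<Rightarrow> nat" where
  "get_num c a = nums c (loc c a)"

definition put_num :: "addr \<Rightarrow> nat \<Rightarrow> ('i, 'o) config \<Rightarrow> ('i, 'o) config" where
  "put_num a v c = c\<lparr>nums := (nums c)(loc c a := v), num_ext := max (num_ext c) (Suc (loc c a))\<rparr>"

definition get_let :: "('i, 'o) config \<Rightarrow> addr \<Rightarrow> ('i, 'o) letter" where
  "get_let c a = lets c (loc c a)"

definition put_let :: "addr \<Rightarrow> ('i, 'o) letter \<Rightarrow> ('i, 'o) config \<Rightarrow> ('i, 'o) config" where
  "put_let a l c = c\<lparr>lets := (lets c)(loc c a := l), let_ext := max (let_ext c) (Suc (loc c a))\<rparr>"

definition goto :: "nat \<Rightarrow> ('i, 'o) config \<Rightarrow> ('i, 'o) config" where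
  "goto k c = c\<lparr>pc := k\<rparr>"

definition next_line :: "('i, 'o) config \<Rightarrow> ('i, 'o) config" where
  "next_line c = c\<lparr>pc := Suc (pc c)\<rparr>"

fun exec :: "'i list \<Rightarrow> ('i, 'o) instr \<Rightarrow> ('i, 'o) config \<Rightarrow> ('i, 'o) config" where
  "exec x (SetConst d k) c = next_line (put_num d k c)"
| "exec x (Arith f d a b) c = next_line (put_num d (arith f (get_num c a) (get_num c b)) c)"
| "exec x (Jump k) c = goto k c"
| "exec x (JumpEq a b k) c = (if get_num c a = get_num c b then goto k c else next_line c)"
| "exec x (JumpLess a b k) c = (if get_num c a < get_num c b then goto k c else next_line c)"
| "exec x (MapLetter f d a) c = next_line (put_let d (f (get_let c a)) c)"
| "exec x (JumpLetter p a k) c = (if p (get_let c a) then goto k c else next_line c)"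
| "exec x (ReadIn d k) c =
     (if in_pos c < length x
      then next_line ((put_let d (InLetter (x ! in_pos c)) c)\<lparr>in_pos := Suc (in_pos c)\<rparr>)
      else goto k c)"
| "exec x RewindIn c = next_line (c\<lparr>in_pos := 0, in_passes := Suc (in_passes c)\<rparr>)"
| "exec x (ReadOut d) c =
     next_line ((put_let d (case out_stream c (out_pos c) of None \<Rightarrow> Blank | Some l \<Rightarrow> OutLetter l) c)
       \<lparr>out_pos := Suc (out_pos c)\<rparr>)"
| "exec x (WriteOut f a) c =
     next_line (c\<lparr>out_stream := (out_stream c)(out_pos c := Some (f (get_let c a))),
                  out_pos := Suc (out_pos c)\<rparr>)"
| "exec x SkipOut c = next_line (c\<lparr>out_pos := Suc (out_pos c)\<rparr>)"
| "exec x RewindOut c = next_line (c\<lparr>out_pos := 0, out_passes := Suc (out_passes c)\<rparr>)"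

definition halted :: "('i, 'o) program \<Rightarrow> ('i, 'o) config \<Rightarrow> bool" where
  "halted A c \<longleftrightarrow> length A \<le> pc c"

definition step :: "('i, 'o) program \<Rightarrow> 'i list \<Rightarrow> ('i, 'o) config \<Rightarrow> ('i, 'o) config" where
  "step A x c = (if halted A c then c else exec x (A ! pc c) c)"

definition run :: "('i, 'o) program \<Rightarrow> 'i list \<Rightarrow> nat \<Rightarrow> ('i, 'o) config" where
  "run A x n = (step A x ^^ n) initial"

text \<open>The next step reads a letter from a stream or writes one. Idle moves do not count: skipping a
  cell, reading an empty cell, and hitting the end of the input.\<close>

definition reads_or_writes :: "('i, 'o) program \<Rightarrow> 'i list \<Rightarrow> ('i, 'o) config \<Rightarrow> bool" where
  "reads_or_writes A x c \<longleftrightarrow> \<not> halted A c \<and>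
     (case A ! pc c of
        ReadIn _ _ \<Rightarrow> in_pos c < length x
      | ReadOut _ \<Rightarrow> out_stream c (out_pos c) \<noteq> None
      | WriteOut _ _ \<Rightarrow> True
      | _ \<Rightarrow> False)"

text \<open>Space in letters and bits: a letter counts 1, a number counts its binary length (at least 1).
  All cells up to the highest one written so far are charged.\<close>

definition space :: "('i, 'o) config \<Rightarrow> nat" where
  "space c = let_ext c + (\<Sum>i<num_ext c. max 1 (floorlog 2 (nums c i)))"

definition uses_space :: "('i, 'o) program \<Rightarrow> 'i list \<Rightarrow> nat \<Rightarrow> bool" where
  "uses_space A x s \<longleftrightarrow> (\<forall>n. space (run A x n) \<le> s)"

text \<open>Any \<open>T\<close> consecutive steps before halting contain a read or write operation. In addition to the
  time between two consecutive operations, this bounds the time before the first one and after the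
  last one.\<close>

definition has_processing_time :: "('i, 'o) program \<Rightarrow> 'i list \<Rightarrow> nat \<Rightarrow> bool" where
  "has_processing_time A x T \<longleftrightarrow>
     (\<forall>n. \<exists>k\<in>{n..<n + T}. halted A (run A x k) \<or> reads_or_writes A x (run A x k))"

text \<open>The side condition under which an arithmetic instruction may be charged a single step: every
  number ever held by the machine, addresses included, is at most \<open>w\<close>.\<close>

definition has_number_bound :: "('i, 'o) program \<Rightarrow> 'i list \<Rightarrow> nat \<Rightarrow> bool" where
  "has_number_bound A x w \<longleftrightarrow> (\<forall>n i. nums (run A x n) i \<le> w)"

text \<open>The program halts on \<open>x\<close> after \<open>p\<close> passes over the input stream and \<open>q\<close> passes over the output
  stream (every rewind starts a new pass), and finally the output stream contains exactly \<open>y\<close>.\<close>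

definition outputs_in_passes ::
  "('i, 'o) program \<Rightarrow> 'i list \<Rightarrow> nat \<Rightarrow> nat \<Rightarrow> 'o list \<Rightarrow> bool" where
  "outputs_in_passes A x p q y \<longleftrightarrow>
     (\<exists>n. halted A (run A x n) \<and> in_passes (run A x n) = p \<and> out_passes (run A x n) = q \<and>
          out_stream (run A x n) = (\<lambda>i. if i < length y then Some (y ! i) else None))"

end

(* The letters are read in blocks, the k-th of which has k * floorlog 2 k letters, so that N nodes
   need O(sqrt (N / log N)) blocks and each block has O(sqrt (N log N)) letters. Between two nodes the
   output consists of opening tags, and of closing tags that are delayed until the next sibling starts
   or until the binary tree closes the last sibling. Hence all that is ever unknown is the label
   of the closing tag to be written before an annotated right child is opened: it is the label of the
   current node of the binary tree, which is known if this node was opened in the current block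
   (a stack of labels is kept for the block). Otherwise a hole is left in the output buffer of the
   block; it is filled when the node is closed. As a right child is the last child of its parent, at
   most one hole is still open when a block ends; its position and the depth of the node go to a table
   that receives the label when the node is closed, and the second pass over the output stream fills
   the holes from this table. *)
theory Submission
  imports Defs
begin

section \<open>Symbolic execution of programs\<close>

text \<open>Two constraints besides space shape the program. The input length is unknown, so the
  block length cannot be tuned to it: it grows with the block number \<open>k\<close>, and the
  binary length of \<open>k\<close> is maintained incrementally, as the machine has no logarithm.
  Processing time is a worst case between consecutive operations, and idle moves do not count. Hence
  flushing must write a letter every few steps, which is why a single hole per block matters, and
  the second pass reads the cells that it passes instead of skipping them. Lookups must take
  constant time as well: the depths of the unfilled holes increase strictly along their stack, so
  only the topmost hole can belong to the node being closed. A ghost state separates the two halves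
  of the argument: the lemmas on \<open>consistent\<close> contain the combinatorics, and the
  program fragments only have to imitate the ghost updates.\<close>

fun addr_of :: "(nat \<Rightarrow> nat) \<Rightarrow> addr \<Rightarrow> nat" where
  "addr_of n (Dir k) = k"
| "addr_of n (Ind k) = n k"

text \<open>From line \<open>p\<close>, with number cells \<open>n\<close>, letter cells \<open>l\<close>, stream positions \<open>ip\<close> and \<open>op\<close> and output
  stream \<open>os\<close> in its \<open>ps\<close>-th pass, and \<open>t\<close> steps after the last read or write operation, the program
  halts with output \<open>y\<close>, writing only number cells below \<open>E1\<close> and letter cells below \<open>E2\<close>, storing only
  numbers up to \<open>w\<close>, and never taking \<open>T\<close> steps without reading or writing.\<close>

inductive safe :: "('i, 'o) program \<Rightarrow> 'i list \<Rightarrow> 'o list \<Rightarrow> nat \<Rightarrow> nat \<Rightarrow> nat \<Rightarrow> nat \<Rightarrow>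
    nat \<Rightarrow> nat \<Rightarrow> (nat \<Rightarrow> nat) \<Rightarrow> (nat \<Rightarrow> ('i, 'o) letter) \<Rightarrow> nat \<Rightarrow> (nat \<Rightarrow> 'o option) \<Rightarrow> nat \<Rightarrow> nat \<Rightarrow> bool"
  for A x y E1 E2 w T where
  halt: "\<lbrakk>p = length A; t < T; ps = 2; os = (\<lambda>i. if i < length y then Some (y ! i) else None)\<rbrakk> \<Longrightarrow>
    safe A x y E1 E2 w T t p n l ip os op ps"
| SetConst: "\<lbrakk>p < length A; A ! p = SetConst d k; t < T; addr_of n d < E1; k \<le> w;
    safe A x y E1 E2 w T (Suc t) (Suc p) (n(addr_of n d := k)) l ip os op ps\<rbrakk> \<Longrightarrow>
    safe A x y E1 E2 w T t p n l ip os op ps"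
| Arith: "\<lbrakk>p < length A; A ! p = Arith f d a b; t < T; addr_of n d < E1;
    arith f (n (addr_of n a)) (n (addr_of n b)) \<le> w;
    safe A x y E1 E2 w T (Suc t) (Suc p)
      (n(addr_of n d := arith f (n (addr_of n a)) (n (addr_of n b)))) l ip os op ps\<rbrakk> \<Longrightarrow>
    safe A x y E1 E2 w T t p n l ip os op ps"
| Jump: "\<lbrakk>p < length A; A ! p = Jump k; t < T; safe A x y E1 E2 w T (Suc t) k n l ip os op ps\<rbrakk> \<Longrightarrow>
    safe A x y E1 E2 w T t p n l ip os op ps"
| JumpEq: "\<lbrakk>p < length A; A ! p = JumpEq a b k; t < T;
    safe A x y E1 E2 w T (Suc t)
      (if n (addr_of n a) = n (addr_of n b) then k else Suc p) n l ip os op ps\<rbrakk> \<Longrightarrow>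
    safe A x y E1 E2 w T t p n l ip os op ps"
| JumpLess: "\<lbrakk>p < length A; A ! p = JumpLess a b k; t < T;
    safe A x y E1 E2 w T (Suc t)
      (if n (addr_of n a) < n (addr_of n b) then k else Suc p) n l ip os op ps\<rbrakk> \<Longrightarrow>
    safe A x y E1 E2 w T t p n l ip os op ps"
| MapLetter: "\<lbrakk>p < length A; A ! p = MapLetter g d a; t < T; addr_of n d < E2;
    safe A x y E1 E2 w T (Suc t) (Suc p) n (l(addr_of n d := g (l (addr_of n a)))) ip os op ps\<rbrakk> \<Longrightarrow>
    safe A x y E1 E2 w T t p n l ip os op ps"
| JumpLetter: "\<lbrakk>p < length A; A ! p = JumpLetter P a k; t < T;
    safe A x y E1 E2 w T (Suc t) (if P (l (addr_of n a)) then k else Suc p) n l ip os op ps\<rbrakk> \<Longrightarrow>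
    safe A x y E1 E2 w T t p n l ip os op ps"
| ReadIn: "\<lbrakk>p < length A; A ! p = ReadIn d k; t < T; addr_of n d < E2;
    if ip < length x
    then safe A x y E1 E2 w T 0 (Suc p) n (l(addr_of n d := InLetter (x ! ip))) (Suc ip) os op ps
    else safe A x y E1 E2 w T (Suc t) k n l ip os op ps\<rbrakk> \<Longrightarrow>
    safe A x y E1 E2 w T t p n l ip os op ps"
| ReadOut: "\<lbrakk>p < length A; A ! p = ReadOut d; t < T; addr_of n d < E2;
    safe A x y E1 E2 w T (if os op = None then Suc t else 0) (Suc p) n
      (l(addr_of n d := (case os op of None \<Rightarrow> Blank | Some b \<Rightarrow> OutLetter b))) ip os (Suc op) ps\<rbrakk> \<Longrightarrow>
    safe A x y E1 E2 w T t p n l ip os op ps"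
| WriteOut: "\<lbrakk>p < length A; A ! p = WriteOut h a; t < T;
    safe A x y E1 E2 w T 0 (Suc p) n l ip (os(op := Some (h (l (addr_of n a))))) (Suc op) ps\<rbrakk> \<Longrightarrow>
    safe A x y E1 E2 w T t p n l ip os op ps"
| SkipOut: "\<lbrakk>p < length A; A ! p = SkipOut; t < T;
    safe A x y E1 E2 w T (Suc t) (Suc p) n l ip os (Suc op) ps\<rbrakk> \<Longrightarrow>
    safe A x y E1 E2 w T t p n l ip os op ps"
| RewindOut: "\<lbrakk>p < length A; A ! p = RewindOut; t < T;
    safe A x y E1 E2 w T (Suc t) (Suc p) n l ip os 0 (Suc ps)\<rbrakk> \<Longrightarrow>
    safe A x y E1 E2 w T t p n l ip os op ps"

text \<open>As an equation, \<open>safe\<close> can be evaluated by the simplifier like an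
  interpreter. As a rewrite rule it is used only at fixed line numbers of the program, since
  unrestricted it would unfold forever.\<close>

lemma safe_unfold:
  "safe A x y E1 E2 w T t p n l ip os op ps \<longleftrightarrow> t < T \<and>
    (if p < length A then
      (case A ! p of
         SetConst d k \<Rightarrow> addr_of n d < E1 \<and> k \<le> w \<and>
           safe A x y E1 E2 w T (Suc t) (Suc p) (n(addr_of n d := k)) l ip os op ps
       | Arith f d a b \<Rightarrow> addr_of n d < E1 \<and> arith f (n (addr_of n a)) (n (addr_of n b)) \<le> w \<and>
           safe A x y E1 E2 w T (Suc t) (Suc p)
             (n(addr_of n d := arith f (n (addr_of n a)) (n (addr_of n b)))) l ip os op ps
       | Jump k \<Rightarrow> safe A x y E1 E2 w T (Suc t) k n l ip os op ps
       | JumpEq a b k \<Rightarrow> safe A x y E1 E2 w T (Suc t)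
           (if n (addr_of n a) = n (addr_of n b) then k else Suc p) n l ip os op ps
       | JumpLess a b k \<Rightarrow> safe A x y E1 E2 w T (Suc t)
           (if n (addr_of n a) < n (addr_of n b) then k else Suc p) n l ip os op ps
       | MapLetter g d a \<Rightarrow> addr_of n d < E2 \<and>
           safe A x y E1 E2 w T (Suc t) (Suc p) n (l(addr_of n d := g (l (addr_of n a)))) ip os op ps
       | JumpLetter P a k \<Rightarrow>
           safe A x y E1 E2 w T (Suc t) (if P (l (addr_of n a)) then k else Suc p) n l ip os op ps
       | ReadIn d k \<Rightarrow> addr_of n d < E2 \<and>
           (if ip < length x
            then safe A x y E1 E2 w T 0 (Suc p) n (l(addr_of n d := InLetter (x ! ip))) (Suc ip) os op ps
            else safe A x y E1 E2 w T (Suc t) k n l ip os op ps)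
       | RewindIn \<Rightarrow> False
       | ReadOut d \<Rightarrow> addr_of n d < E2 \<and>
           safe A x y E1 E2 w T (if os op = None then Suc t else 0) (Suc p) n
             (l(addr_of n d := (case os op of None \<Rightarrow> Blank | Some b \<Rightarrow> OutLetter b))) ip os (Suc op) ps
       | WriteOut h a \<Rightarrow>
           safe A x y E1 E2 w T 0 (Suc p) n l ip (os(op := Some (h (l (addr_of n a))))) (Suc op) ps
       | SkipOut \<Rightarrow> safe A x y E1 E2 w T (Suc t) (Suc p) n l ip os (Suc op) ps
       | RewindOut \<Rightarrow> safe A x y E1 E2 w T (Suc t) (Suc p) n l ip os 0 (Suc ps))
     else p = length A \<and> ps = 2 \<and> os = (\<lambda>i. if i < length y then Some (y ! i) else None))"
  (is "_ \<longleftrightarrow> ?r")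
proof
  assume "safe A x y E1 E2 w T t p n l ip os op ps"
  then show ?r
    by (cases rule: safe.cases) auto
next
  assume r: ?r
  show "safe A x y E1 E2 w T t p n l ip os op ps"
  proof (cases "p < length A")
    case False
    with r show ?thesis by (auto intro: safe.halt)
  next
    case True
    then show ?thesis
      using r by (cases "A ! p") (auto intro: safe.intros simp del: fun_upd_apply)
  qed
qed

section \<open>From symbolic execution to runs of the machine\<close>

definition fits :: "nat \<Rightarrow> nat \<Rightarrow> nat \<Rightarrow> ('i, 'o) config \<Rightarrow> bool" where
  "fits E1 E2 w c \<longleftrightarrow> num_ext c \<le> E1 \<and> let_ext c \<le> E2 \<and> (\<forall>i. nums c i \<le> w)"

definition active :: "('i, 'o) program \<Rightarrow> 'i list \<Rightarrow> ('i, 'o) config \<Rightarrow> bool" where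
  "active A x c \<longleftrightarrow> halted A c \<or> reads_or_writes A x c"

text \<open>Fewer than \<open>T - t\<close> steps remain until the next operation: this is what \<open>t\<close> steps already spent
  since the last one leave of the budget.\<close>

definition accepted where
  "accepted A x y E1 E2 w T t c \<longleftrightarrow>
     (\<forall>j. fits E1 E2 w ((step A x ^^ j) c)) \<and>
     (\<forall>j. \<exists>k\<in>{j..<j + T}. active A x ((step A x ^^ k) c)) \<and>
     (\<exists>k. k + t < T \<and> active A x ((step A x ^^ k) c)) \<and>
     (\<exists>j. let c' = (step A x ^^ j) c in halted A c' \<and> in_passes c' = in_passes c \<and> out_passes c' = 2 \<and>
        out_stream c' = (\<lambda>i. if i < length y then Some (y ! i) else None))"

text \<open>The windows of length \<open>T\<close> that start later are windows of the run from the
  next configuration. Only the first window is new, and it is settled by the clause of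
  \<open>accepted\<close> on the remaining budget.\<close>

lemma accepted_step:
  assumes "fits E1 E2 w c" "t < T" "in_passes (step A x c) = in_passes c"
    and acc: "accepted A x y E1 E2 w T (if reads_or_writes A x c then 0 else Suc t) (step A x c)"
  shows "accepted A x y E1 E2 w T t c"
proof -
  let ?c = "step A x c"
  have sh: "(step A x ^^ Suc j) c = (step A x ^^ j) ?c" for j
    by (simp only: funpow_Suc_right o_apply)
  have w: "fits E1 E2 w ((step A x ^^ j) c)" for j
    using acc assms(1) sh by (cases j) (auto simp: accepted_def simp del: funpow.simps(2))
  have k: "\<exists>k. k + t < T \<and> active A x ((step A x ^^ k) c)"
  proof (cases "reads_or_writes A x c")
    case True
    then show ?thesis using assms(2) by (intro exI[of _ 0]) (auto simp: active_def)
  next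
    case False
    with acc obtain k where "k + Suc t < T" "active A x ((step A x ^^ k) ?c)"
      by (auto simp: accepted_def)
    then show ?thesis using sh[of k] by (intro exI[of _ "Suc k"]) (simp del: funpow.simps(2))
  qed
  have "\<exists>k\<in>{j..<j + T}. active A x ((step A x ^^ k) c)" for j
  proof (cases j)
    case 0
    from k obtain k where "k < T" "active A x ((step A x ^^ k) c)"
      by (meson add_lessD1)
    then show ?thesis using 0 by auto
  next
    case (Suc j')
    have "\<exists>k\<in>{j'..<j' + T}. active A x ((step A x ^^ k) ?c)"
      using acc by (simp add: accepted_def)
    then obtain k where k: "k\<in>{j'..<j' + T}" "active A x ((step A x ^^ k) ?c)"
      by blast
    then have "Suc k \<in> {j..<j + T}" using Suc by auto
    then show ?thesis using k sh[of k] by metis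
  qed
  moreover obtain j where "let c' = (step A x ^^ j) ?c in halted A c' \<and> in_passes c' = in_passes ?c \<and>
      out_passes c' = 2 \<and> out_stream c' = (\<lambda>i. if i < length y then Some (y ! i) else None)"
    using acc by (auto simp: accepted_def)
  then have "\<exists>j. let c' = (step A x ^^ j) c in halted A c' \<and> in_passes c' = in_passes c \<and>
      out_passes c' = 2 \<and> out_stream c' = (\<lambda>i. if i < length y then Some (y ! i) else None)"
    unfolding assms(3) using sh[of j] by (intro exI[of _ "Suc j"]) (simp only:)
  ultimately show ?thesis using w k by (auto simp: accepted_def)
qed

lemma loc_addr_of: "loc c a = addr_of (nums c) a"
  by (cases a) auto

lemmas step_simps = step_def fits_def halted_def reads_or_writes_def put_num_def put_let_def goto_def
  next_line_def get_num_def get_let_def loc_addr_of fun_upd_def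

text \<open>\<open>safe\<close> keeps no record of the extents \<open>ne\<close> and
  \<open>le\<close>, which grow during the run; they are generalised in the induction, and each rule
  bounds just the cell that it writes. With no rule for \<open>RewindIn\<close>, the number of input
  passes stays fixed.\<close>

lemma safe_accepted:
  assumes "safe A x y E1 E2 w T t p n l ip os op ps"
  shows "\<lbrakk>\<And>i. n i \<le> w; ne \<le> E1; le \<le> E2\<rbrakk> \<Longrightarrow> accepted A x y E1 E2 w T t
    \<lparr>pc = p, nums = n, num_ext = ne, lets = l, let_ext = le, in_pos = ip, in_passes = ips,
     out_stream = os, out_pos = op, out_passes = ps\<rparr>"
  using assms
proof (induction arbitrary: ne le rule: safe.induct)
  case (halt p t ps os n l ip op)
  let ?c = "\<lparr>pc = p, nums = n, num_ext = ne, lets = l, let_ext = le, in_pos = ip, in_passes = ips,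
     out_stream = os, out_pos = op, out_passes = ps\<rparr>"
  have h: "halted A ?c" using halt by (simp add: halted_def)
  have "(step A x ^^ j) ?c = ?c" for j
    by (induction j) (use h in \<open>simp_all add: step_def\<close>)
  moreover have "fits E1 E2 w ?c" using halt by (simp add: fits_def)
  moreover have "0 + t < T" "j \<in> {j..<j + T}" for j
    using halt(2) by auto
  then have "\<exists>k. k + t < T" "{j..<j + T} \<noteq> {}" for j
    by blast+
  ultimately show ?case using halt(1-4) h
    unfolding accepted_def active_def Let_def by auto
next
  case (SetConst p d k t n l ip os op ps)
  show ?case
    by (rule accepted_step) (use SetConst in \<open>simp_all add: step_simps\<close>)
next
  case (Arith p f d a b t n l ip os op ps)
  show ?case
    by (rule accepted_step) (use Arith in \<open>simp_all add: step_simps\<close>)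
next
  case (Jump p k t n l ip os op ps)
  show ?case
    by (rule accepted_step) (use Jump in \<open>simp_all add: step_simps\<close>)
next
  case (JumpEq p a b k t n l ip os op ps)
  show ?case
    by (rule accepted_step) (cases "n (addr_of n a) = n (addr_of n b)"; use JumpEq in \<open>simp add: step_simps\<close>)+
next
  case (JumpLess p a b k t n l ip os op ps)
  show ?case
    by (rule accepted_step) (cases "n (addr_of n a) < n (addr_of n b)"; use JumpLess in \<open>simp add: step_simps\<close>)+
next
  case (MapLetter p g d a t n l ip os op ps)
  show ?case
    by (rule accepted_step) (use MapLetter in \<open>simp_all add: step_simps\<close>)
next
  case (JumpLetter p P a k t l n ip os op ps)
  show ?case
    by (rule accepted_step) (cases "P (l (addr_of n a))"; use JumpLetter in \<open>simp add: step_simps\<close>)+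
next
  case (ReadIn p d k t n ip l os op ps)
  show ?case
    by (rule accepted_step) (cases "ip < length x"; use ReadIn in \<open>simp add: step_simps\<close>)+
next
  case (ReadOut p d t n os op l ip ps)
  show ?case
    by (rule accepted_step) (cases "os op"; use ReadOut in \<open>simp add: step_simps\<close>)+
next
  case (WriteOut p h a t n l ip os op ps)
  show ?case
    by (rule accepted_step) (use WriteOut in \<open>simp_all add: step_simps\<close>)
next
  case (SkipOut p t n l ip os op ps)
  show ?case
    by (rule accepted_step) (use SkipOut in \<open>simp_all add: step_simps\<close>)
next
  case (RewindOut p t n l ip os op ps)
  show ?case
    by (rule accepted_step) (use RewindOut in \<open>simp_all add: step_simps\<close>)
qed

lemma space_le:
  assumes "fits E1 E2 w c"
  shows "space c \<le> E2 + E1 * Suc (floorlog 2 w)"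
proof -
  have "(\<Sum>i<num_ext c. max 1 (floorlog 2 (nums c i))) \<le> (\<Sum>i<num_ext c. Suc (floorlog 2 w))"
    using assms by (intro sum_mono) (auto simp: fits_def le_SucI floorlog_mono)
  also have "\<dots> = num_ext c * Suc (floorlog 2 w)"
    by simp
  also have "\<dots> \<le> E1 * Suc (floorlog 2 w)"
    using assms by (intro mult_le_mono1) (simp add: fits_def)
  finally show ?thesis
    using assms by (simp add: space_def fits_def)
qed

theorem safe_initial:
  assumes "safe A x y E1 E2 w T 0 0 (\<lambda>_. 0) (\<lambda>_. Blank) 0 (\<lambda>_. None) 0 1"
  shows "outputs_in_passes A x 1 2 y" "uses_space A x (E2 + E1 * Suc (floorlog 2 w))"
    "has_processing_time A x T" "has_number_bound A x w"
proof -
  have acc: "accepted A x y E1 E2 w T 0 initial"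
    using safe_accepted[OF assms, of 0 0 1] by (simp add: initial_def)
  then show "outputs_in_passes A x 1 2 y"
    by (auto simp: accepted_def outputs_in_passes_def run_def Let_def initial_def)
  have w: "fits E1 E2 w (run A x n)" for n
    using acc by (auto simp: accepted_def run_def)
  show "uses_space A x (E2 + E1 * Suc (floorlog 2 w))"
    unfolding uses_space_def by (intro allI space_le w)
  show "has_processing_time A x T"
    using acc by (auto simp: accepted_def has_processing_time_def run_def active_def)
  show "has_number_bound A x w"
    unfolding has_number_bound_def using w by (auto simp: fits_def)
qed

section \<open>Tags, holes and the invariant of the algorithm\<close>

text \<open>In both functions \<open>st\<close> lists the labels of the open nodes of the binary tree, the innermost first,
  and \<open>f\<close> says that the last tag closed a right child, i.e. that the current node has a right child
  which is complete. In \<open>emits\<close> the right child of a node is responsible for the closing tag of that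
  node (its previous sibling); a node without right child writes its own.\<close>

fun matched :: "('a \<times> side) list \<Rightarrow> bool \<Rightarrow> ('a \<times> side) tag list \<Rightarrow> bool" where
  "matched st f [] \<longleftrightarrow> st = []"
| "matched st f (Opening b # r) \<longleftrightarrow>
     \<not> f \<and> (snd b = RightChild \<longrightarrow> st \<noteq> []) \<and> matched (b # st) False r"
| "matched st f (Closing b # r) \<longleftrightarrow>
     st \<noteq> [] \<and> hd st = b \<and> matched (tl st) (snd b = RightChild) r"

fun emits :: "('a \<times> side) list \<Rightarrow> bool \<Rightarrow> ('a \<times> side) tag list \<Rightarrow> 'a tag list" where
  "emits st f [] = []"
| "emits st f (Opening b # r) = (if snd b = RightChild then [Closing (fst (hd st))] else []) @
     Opening (fst b) # emits (b # st) False r"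
| "emits st f (Closing b # r) = (if f then [] else [Closing (fst b)]) @
     emits (tl st) (snd b = RightChild) r"

text \<open>One induction covers both sides, because each node leads to a list of children and a
  list of siblings. A right subtree is stated together with the closing tag of its parent: without
  that tag the flag would depend on whether the subtree is empty.\<close>

lemma matched_fcns_from:
  "(s = LeftChild \<longrightarrow> (\<forall>st r. matched st False (xml_bin (fcns_from s ts) @ r) = matched st False r)) \<and>
   (s = RightChild \<longrightarrow> (\<forall>b st r. matched (b # st) False (xml_bin (fcns_from s ts) @ Closing b # r) =
      matched st (snd b = RightChild) r))"
  by (induction s ts rule: fcns_from.induct) auto

text \<open>In \<open>xml\<close> the closing tag of a node precedes its next siblings. It is
  written by the first of these if there is one, and by the closing tag of the node otherwise, so in
  both cases it heads the output of the right subtree.\<close>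

lemma emits_fcns_from:
  "(s = LeftChild \<longrightarrow> (\<forall>st r. emits st False (xml_bin (fcns_from s ts) @ r) =
      concat (map xml ts) @ emits st False r)) \<and>
   (s = RightChild \<longrightarrow> (\<forall>b st r. emits (b # st) False (xml_bin (fcns_from s ts) @ Closing b # r) =
      Closing (fst b) # concat (map xml ts) @ emits st (snd b = RightChild) r))"
  by (induction s ts rule: fcns_from.induct) auto

lemma matched_fcns: "matched [] False (xml_bin (fcns t))"
proof -
  have "matched st False (xml_bin (fcns_from LeftChild ts) @ r) = matched st False r" for st ts r
    using matched_fcns_from[of LeftChild ts] by simp
  from this[of "[]" "[t]" "[]"] show ?thesis by (simp add: fcns_def)
qed

lemma emits_fcns: "emits [] False (xml_bin (fcns t)) = xml t"
proof -
  have "emits st False (xml_bin (fcns_from LeftChild ts) @ r) = concat (map xml ts) @ emits st False r"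
    for st ts r
    using emits_fcns_from[of LeftChild ts] by simp
  from this[of "[]" "[t]" "[]"] show ?thesis by (simp add: fcns_def)
qed

lemma length_xml: "length (xml t) = 2 * num_nodes t"
proof (induction t)
  case (UNode a ts)
  then have "sum_list (map (length \<circ> xml) ts) = 2 * sum_list (map num_nodes ts)"
    by (induction ts) auto
  then show ?case by (simp add: length_concat comp_def)
qed

lemma length_xml_bin_fcns: "length (xml_bin (fcns t)) = 2 * num_nodes t"
proof -
  have "length (xml_bin (fcns_from s ts)) = 2 * sum_list (map num_nodes ts)" for s and ts :: "'a utree list"
    by (induction s ts rule: fcns_from.induct) auto
  from this[of LeftChild "[t]"] show ?thesis by (simp add: fcns_def)
qed

section \<open>The ghost state and its invariant\<close>

text \<open>\<open>ancestors\<close>, \<open>right_done\<close> and \<open>ideal\<close> (the output that an algorithm with unbounded memory would have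
  produced) are not known to the program. The \<open>stack_size\<close> innermost ancestors were opened in the
  current block. A candidate is the index of a buffer cell that awaits its letter. The holes on the
  output stream are numbered from 0 in the order of their positions; the unfilled ones form a stack,
  indexed from 1, of pairs of an identifier \<open>hole_id\<close> and the depth \<open>hole_depth\<close> of the open node whose
  label is missing.\<close>

record 'a ghost =
  ancestors :: "('a \<times> side) list"
  right_done :: bool
  ideal :: "'a tag list"
  stack_size :: nat
  stack_cell :: "nat \<Rightarrow> (('a \<times> side) tag, 'a tag) letter"
  buf_size :: nat
  buf_cell :: "nat \<Rightarrow> (('a \<times> side) tag, 'a tag) letter"
  candidate :: "nat option"
  flushed :: nat
  written :: "nat \<Rightarrow> 'a tag option"
  holes :: nat
  hole_pos :: "nat \<Rightarrow> nat"
  label_cell :: "nat \<Rightarrow> (('a \<times> side) tag, 'a tag) letter"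
  unfilled :: nat
  hole_depth :: "nat \<Rightarrow> nat"
  hole_id :: "nat \<Rightarrow> nat"

definition stack_ok :: "'a ghost \<Rightarrow> bool" where
  "stack_ok g \<longleftrightarrow> stack_size g \<le> length (ancestors g) \<and>
     (\<forall>j<stack_size g. stack_cell g (stack_size g - j) = InLetter (Opening (ancestors g ! j)))"

definition buf_ok :: "'a ghost \<Rightarrow> bool" where
  "buf_ok g \<longleftrightarrow> flushed g + buf_size g = length (ideal g) \<and>
     (\<forall>j<buf_size g. buf_cell g j =
        (if candidate g = Some j then Blank else OutLetter (ideal g ! (flushed g + j))))"

text \<open>The missing label is that of the innermost ancestor opened before the current block. The
  later clauses prepare its move to the table of holes: its right child has been opened, so its
  closing tag is not requested again, and its depth exceeds all stored depths, so the stack of holes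
  stays sorted.\<close>

definition cand_ok :: "'a ghost \<Rightarrow> bool" where
  "cand_ok g \<longleftrightarrow> (\<forall>j. candidate g = Some j \<longrightarrow>
     j < buf_size g \<and> stack_size g < length (ancestors g) \<and>
     ideal g ! (flushed g + j) = Closing (fst (ancestors g ! stack_size g)) \<and>
     (stack_size g = 0 \<longrightarrow> right_done g) \<and>
     (stack_size g > 0 \<longrightarrow> snd (ancestors g ! (stack_size g - 1)) = RightChild) \<and>
     (\<forall>i\<in>{1..unfilled g}. hole_depth g i < length (ancestors g) - stack_size g))"

definition written_ok :: "'a ghost \<Rightarrow> bool" where
  "written_ok g \<longleftrightarrow> written g = (\<lambda>i. if i < flushed g \<and> (\<forall>h<holes g. i \<noteq> hole_pos g h)
       then Some (ideal g ! i) else None) \<and>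
     (\<forall>h<holes g. hole_pos g h < flushed g \<and> (\<forall>h'<h. hole_pos g h' < hole_pos g h)) \<and>
     (\<forall>h<holes g. label_cell g h = OutLetter (ideal g ! hole_pos g h) \<or>
       (\<exists>i\<in>{1..unfilled g}. hole_id g i = h))"

text \<open>Depth counts from 1 at the root, so the ancestor at depth \<open>d\<close> has index
  \<open>length (ancestors g) - d\<close>. The strict growth of the depths makes the topmost hole
  the only one that can match the current node.\<close>

definition unfilled_ok :: "'a ghost \<Rightarrow> bool" where
  "unfilled_ok g \<longleftrightarrow> unfilled g \<le> holes g \<and>
     (\<forall>i\<in>{1..unfilled g}. hole_id g i < holes g \<and> 1 \<le> hole_depth g i \<and>
        hole_depth g i + stack_size g \<le> length (ancestors g) \<and>
        ideal g ! hole_pos g (hole_id g i) =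
          Closing (fst (ancestors g ! (length (ancestors g) - hole_depth g i))) \<and>
        (hole_depth g i < length (ancestors g) \<longrightarrow>
          snd (ancestors g ! (length (ancestors g) - hole_depth g i - 1)) = RightChild) \<and>
        (hole_depth g i = length (ancestors g) \<longrightarrow> right_done g) \<and>
        (\<forall>i'\<in>{1..<i}. hole_depth g i' < hole_depth g i))"

definition consistent :: "'a ghost \<Rightarrow> bool" where
  "consistent g \<longleftrightarrow> stack_ok g \<and> buf_ok g \<and> cand_ok g \<and> written_ok g \<and> unfilled_ok g"

lemmas consistent_defs =
  consistent_def stack_ok_def buf_ok_def cand_ok_def written_ok_def unfilled_ok_def

section \<open>Ghost updates and the invariant\<close>

definition emit :: "'a tag \<Rightarrow> 'a ghost \<Rightarrow> 'a ghost" where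
  "emit z g = g\<lparr>ideal := ideal g @ [z], buf_size := Suc (buf_size g),
     buf_cell := (buf_cell g)(buf_size g := OutLetter z)\<rparr>"

definition emit_hole :: "'a tag \<Rightarrow> 'a ghost \<Rightarrow> 'a ghost" where
  "emit_hole z g = g\<lparr>ideal := ideal g @ [z], buf_size := Suc (buf_size g),
     buf_cell := (buf_cell g)(buf_size g := Blank), candidate := Some (buf_size g)\<rparr>"

definition push :: "'a \<times> side \<Rightarrow> 'a ghost \<Rightarrow> 'a ghost" where
  "push b g = g\<lparr>ancestors := b # ancestors g, right_done := False, stack_size := Suc (stack_size g),
     stack_cell := (stack_cell g)(Suc (stack_size g) := InLetter (Opening b))\<rparr>"

definition pop :: "'a ghost \<Rightarrow> 'a ghost" where
  "pop g = g\<lparr>ancestors := tl (ancestors g), right_done := (snd (hd (ancestors g)) = RightChild),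
     stack_size := stack_size g - 1\<rparr>"

definition fill_candidate :: "'a tag \<Rightarrow> nat \<Rightarrow> 'a ghost \<Rightarrow> 'a ghost" where
  "fill_candidate z j g = g\<lparr>candidate := None, buf_cell := (buf_cell g)(j := OutLetter z)\<rparr>"

definition fill_hole :: "'a tag \<Rightarrow> 'a ghost \<Rightarrow> 'a ghost" where
  "fill_hole z g = g\<lparr>unfilled := unfilled g - 1,
     label_cell := (label_cell g)(hole_id g (unfilled g) := OutLetter z)\<rparr>"

definition store_hole :: "nat \<Rightarrow> 'a ghost \<Rightarrow> 'a ghost" where
  "store_hole pos g = g\<lparr>holes := Suc (holes g), hole_pos := (hole_pos g)(holes g := pos),
     unfilled := Suc (unfilled g),
     hole_depth := (hole_depth g)(Suc (unfilled g) := length (ancestors g) - stack_size g),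
     hole_id := (hole_id g)(Suc (unfilled g) := holes g)\<rparr>"

lemma consistent_emit: "consistent g \<Longrightarrow> consistent (emit z g)"
  unfolding consistent_defs emit_def
  by (auto simp: nth_append less_Suc_eq)

text \<open>Makes a single candidate cell per block enough: a hole is created when the label stack
  is empty and the current node has no complete right child, and then no other one is
  pending.\<close>

lemma no_candidate: "\<lbrakk>consistent g; \<not> right_done g; stack_size g = 0\<rbrakk> \<Longrightarrow> candidate g = None"
  unfolding consistent_defs by (cases "candidate g") auto

lemma unfilledD:
  assumes "consistent g" "i \<in> {1..unfilled g}"
  shows "hole_id g i < holes g" "1 \<le> hole_depth g i"
    "hole_depth g i + stack_size g \<le> length (ancestors g)"
    "ideal g ! hole_pos g (hole_id g i) =
       Closing (fst (ancestors g ! (length (ancestors g) - hole_depth g i)))"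
    "hole_depth g i < length (ancestors g) \<Longrightarrow>
       snd (ancestors g ! (length (ancestors g) - hole_depth g i - 1)) = RightChild"
    "hole_depth g i = length (ancestors g) \<Longrightarrow> right_done g"
    "i' \<in> {1..<i} \<Longrightarrow> hole_depth g i' < hole_depth g i"
  using assms unfolding consistent_def unfilled_ok_def by simp_all

text \<open>A hole waiting for the current node exists only once the right child of that node is
  complete, which would have set the flag.\<close>

lemma unfilled_depth:
  assumes "consistent g" "\<not> right_done g" "i \<in> {1..unfilled g}"
  shows "hole_depth g i < length (ancestors g)"
  using unfilledD(3,6)[OF assms(1,3)] assms(2) by (meson add_leD1 le_neq_implies_less)

lemma nth_Cons_diff:
  "d \<le> length xs \<Longrightarrow> (x # xs) ! (Suc (length xs) - d) = xs ! (length xs - d)"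
  by (simp add: Suc_diff_le)

text \<open>The delicate case is a hole waiting for the current node, as it would force the new
  child to be a right child; \<open>unfilled_depth\<close> excludes it. With an empty label stack a
  pending candidate is excluded for the same reason.\<close>

lemma consistent_push:
  assumes g: "consistent g" and f: "\<not> right_done g"
  shows "consistent (push b g)"
proof -
  note d = unfilled_depth[OF g f]
  have "stack_ok (push b g)"
    using g unfolding consistent_defs push_def by (auto simp: nth_Cons split: nat.split)
  moreover have "buf_ok (push b g)" "written_ok (push b g)"
    using g unfolding consistent_defs push_def by auto
  moreover have "cand_ok (push b g)"
    using g f unfolding consistent_defs push_def
    by (auto simp: nth_Cons gr0_conv_Suc split: nat.split)
  moreover have "unfilled_ok (push b g)"
    unfolding unfilled_ok_def
  proof (intro conjI ballI)
    show "unfilled (push b g) \<le> holes (push b g)"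
      using g unfolding consistent_defs push_def by auto
  next
    fix i assume "i \<in> {1..unfilled (push b g)}"
    then have i: "i \<in> {1..unfilled g}" by (simp add: push_def)
    note u = unfilledD[OF g i] d[OF i]
    have le: "hole_depth g i \<le> length (ancestors g)" using u(8) by simp
    show "hole_id (push b g) i < holes (push b g)" "1 \<le> hole_depth (push b g) i"
      "hole_depth (push b g) i + stack_size (push b g) \<le> length (ancestors (push b g))"
      using u(1-3) by (simp_all add: push_def)
    show "ideal (push b g) ! hole_pos (push b g) (hole_id (push b g) i) =
         Closing (fst (ancestors (push b g) ! (length (ancestors (push b g)) - hole_depth (push b g) i)))"
      using u(4) le by (simp add: push_def nth_Cons_diff)
    show "hole_depth (push b g) i < length (ancestors (push b g)) \<longrightarrow>
         snd (ancestors (push b g) ! (length (ancestors (push b g)) - hole_depth (push b g) i - 1)) = RightChild"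
      using u(5,8) by (auto simp: push_def nth_Cons')
    show "hole_depth (push b g) i = length (ancestors (push b g)) \<longrightarrow> right_done (push b g)"
      using le by (simp add: push_def)
    show "hole_depth (push b g) i' < hole_depth (push b g) i" if "i' \<in> {1..<i}" for i'
      using u(7) that by (simp add: push_def)
  qed
  ultimately show ?thesis by (simp add: consistent_def)
qed

text \<open>\<open>emit_hole\<close> alone breaks \<open>cand_ok\<close>: the right child that
  justifies the hole is not among the ancestors yet. Therefore the node is pushed first, which
  commutes with emitting the hole.\<close>

lemma consistent_emit_hole_push:
  assumes g: "consistent g" and f: "\<not> right_done g" and s: "stack_size g = 0" "ancestors g \<noteq> []"
    and b: "snd b = RightChild"
  shows "consistent (push b (emit_hole (Closing (fst (hd (ancestors g)))) g))"
proof -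
  let ?g = "push b g" and ?z = "Closing (fst (hd (ancestors g)))"
  have c: "consistent ?g" by (rule consistent_push[OF g f])
  have n: "candidate ?g = None" using no_candidate[OF g f s(1)] by (simp add: push_def)
  have d: "hole_depth ?g i < length (ancestors ?g) - stack_size ?g" if "i \<in> {1..unfilled ?g}" for i
    using unfilled_depth[OF g f, of i] that s by (simp add: push_def)
  have l: "stack_size ?g = 1" "snd (ancestors ?g ! 0) = RightChild" "1 < length (ancestors ?g)"
      "?z = Closing (fst (ancestors ?g ! 1))"
    using s b by (simp_all add: push_def hd_conv_nth)
  have "buf_ok (emit_hole ?z ?g)" "cand_ok (emit_hole ?z ?g)" "stack_ok (emit_hole ?z ?g)"
    using c n d l unfolding consistent_defs emit_hole_def by (auto simp: nth_append less_Suc_eq)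
  moreover have "written_ok (emit_hole ?z ?g)" "unfilled_ok (emit_hole ?z ?g)"
    using c unfolding consistent_defs emit_hole_def by (auto simp: nth_append)
  ultimately have "consistent (emit_hole ?z ?g)" by (simp add: consistent_def)
  moreover have "emit_hole ?z ?g = push b (emit_hole ?z g)"
    by (simp add: emit_hole_def push_def)
  ultimately show ?thesis by simp
qed

text \<open>The depth hypothesis of the next lemma holds after a possible match with the topmost unfilled
  hole, and it holds trivially when the closed node was opened in the current block.\<close>

lemma consistent_pop:
  assumes g: "consistent g" and ne: "ancestors g \<noteq> []"
    and c: "stack_size g = 0 \<Longrightarrow> candidate g = None"
    and d: "\<And>i. i \<in> {1..unfilled g} \<Longrightarrow> hole_depth g i < length (ancestors g)"
  shows "consistent (pop g)"
proof -
  obtain b st where st: "ancestors g = b # st" using ne by (cases "ancestors g") auto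
  have "stack_cell g (stack_size g - Suc j) = InLetter (Opening (st ! j))" if "Suc j < stack_size g" for j
    using g that st by (simp add: consistent_def stack_ok_def)
  moreover have "stack_size g - 1 \<le> length st"
    using g st by (auto simp: consistent_def stack_ok_def)
  ultimately have "stack_ok (pop g)"
    using st by (simp add: stack_ok_def pop_def)
  moreover have "buf_ok (pop g)" "written_ok (pop g)"
    using g unfolding consistent_defs pop_def by auto
  moreover have "cand_ok g" using g by (simp add: consistent_def)
  then have "cand_ok (pop g)"
    using st c unfolding cand_ok_def pop_def
    by (cases "stack_size g") (auto simp: nth_Cons')
  moreover have "unfilled_ok (pop g)"
    unfolding unfilled_ok_def
  proof (intro conjI ballI)
    show "unfilled (pop g) \<le> holes (pop g)"
      using g unfolding consistent_defs pop_def by auto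
  next
    fix i assume "i \<in> {1..unfilled (pop g)}"
    then have i: "i \<in> {1..unfilled g}" by (simp add: pop_def)
    note u = unfilledD[OF g i] d[OF i]
    have le: "hole_depth g i \<le> length st" using u(8) st by simp
    show "hole_id (pop g) i < holes (pop g)" "1 \<le> hole_depth (pop g) i"
      using u(1,2) by (simp_all add: pop_def)
    show "hole_depth (pop g) i + stack_size (pop g) \<le> length (ancestors (pop g))"
      using u(3) le st by (simp add: pop_def)
    show "ideal (pop g) ! hole_pos (pop g) (hole_id (pop g) i) =
         Closing (fst (ancestors (pop g) ! (length (ancestors (pop g)) - hole_depth (pop g) i)))"
      using u(4) le by (simp add: pop_def st nth_Cons_diff)
    show "hole_depth (pop g) i < length (ancestors (pop g)) \<longrightarrow>
         snd (ancestors (pop g) ! (length (ancestors (pop g)) - hole_depth (pop g) i - 1)) = RightChild"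
      using u(5,8) by (auto simp: pop_def st nth_Cons')
    \<comment> \<open>A hole of the new current node says that the popped node was its right child,
      and this is what sets the flag.\<close>
    show "hole_depth (pop g) i = length (ancestors (pop g)) \<longrightarrow> right_done (pop g)"
      using u(5,8) by (auto simp: pop_def st)
    show "hole_depth (pop g) i' < hole_depth (pop g) i" if "i' \<in> {1..<i}" for i'
      using u(7) that by (simp add: pop_def)
  qed
  ultimately show ?thesis by (simp add: consistent_def)
qed

lemma stack_size_le: "consistent g \<Longrightarrow> stack_size g \<le> length (ancestors g)"
  by (simp add: consistent_def stack_ok_def)

lemma consistent_pop_inside:
  assumes g: "consistent g" and s: "stack_size g > 0"
  shows "consistent (pop g)"
proof (rule consistent_pop[OF g])
  show "ancestors g \<noteq> []" using stack_size_le[OF g] s by auto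
  show "hole_depth g i < length (ancestors g)" if "i \<in> {1..unfilled g}" for i
    using unfilledD(3)[OF g that] s by simp
qed (use s in simp)

text \<open>With an empty label stack the candidate waits for the current node. The depth clause of
  \<open>cand_ok\<close> then rules out that a hole of an earlier block waits for the same node, so
  the table need not be consulted.\<close>

lemma consistent_pop_candidate:
  assumes g: "consistent g" and s: "stack_size g = 0" and j: "candidate g = Some j"
  shows "consistent (pop (fill_candidate (Closing (fst (hd (ancestors g)))) j g))"
proof (rule consistent_pop)
  let ?g = "fill_candidate (Closing (fst (hd (ancestors g)))) j g"
  have "cand_ok g" using g by (simp add: consistent_def)
  then have *: "j < buf_size g" "0 < length (ancestors g)"
      "ideal g ! (flushed g + j) = Closing (fst (ancestors g ! 0))"
      "\<And>i. i \<in> {1..unfilled g} \<Longrightarrow> hole_depth g i < length (ancestors g)"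
    using j s unfolding cand_ok_def by auto
  then have "buf_ok ?g"
    using g j unfolding consistent_defs fill_candidate_def by (auto simp: hd_conv_nth)
  moreover have "stack_ok ?g" "cand_ok ?g" "written_ok ?g" "unfilled_ok ?g"
    using g unfolding consistent_defs fill_candidate_def by auto
  ultimately show "consistent ?g" by (simp add: consistent_def)
  show "ancestors ?g \<noteq> []" using * by (auto simp: fill_candidate_def)
  show "hole_depth ?g i < length (ancestors ?g)" if "i \<in> {1..unfilled ?g}" for i
    using *(4) that by (simp add: fill_candidate_def)
qed (simp add: fill_candidate_def)

text \<open>Filling the topmost hole suffices, because all holes below it have strictly smaller
  depth and so belong to nodes that stay open.\<close>

lemma consistent_pop_hole:
  assumes g: "consistent g" and s: "stack_size g = 0" and j: "candidate g = None"
    and u: "unfilled g > 0" and d: "hole_depth g (unfilled g) = length (ancestors g)"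
  shows "consistent (pop (fill_hole (Closing (fst (hd (ancestors g)))) g))"
proof (rule consistent_pop)
  let ?g = "fill_hole (Closing (fst (hd (ancestors g)))) g"
  have ui: "unfilled g \<in> {1..unfilled g}" using u by simp
  have ne: "ancestors g \<noteq> []" using unfilledD(2)[OF g ui] d by auto
  have z: "ideal g ! hole_pos g (hole_id g (unfilled g)) = Closing (fst (hd (ancestors g)))"
    using unfilledD(4)[OF g ui] d ne by (simp add: hd_conv_nth)
  have w: "label_cell ?g h = OutLetter (ideal ?g ! hole_pos ?g h) \<or> (\<exists>i\<in>{1..unfilled ?g}. hole_id ?g i = h)"
    if h: "h < holes ?g" for h
  proof (cases "h = hole_id g (unfilled g)")
    case True
    then show ?thesis using z by (simp add: fill_hole_def)
  next
    case False
    have "label_cell g h = OutLetter (ideal g ! hole_pos g h) \<or> (\<exists>i\<in>{1..unfilled g}. hole_id g i = h)"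
      using g h by (simp add: consistent_def written_ok_def fill_hole_def)
    moreover have "i \<in> {1..unfilled g - 1}" if "i \<in> {1..unfilled g}" "hole_id g i = h" for i
      using that False by (cases "i = unfilled g") auto
    ultimately show ?thesis
      using False by (auto simp: fill_hole_def)
  qed
  have "written_ok ?g"
    using g w unfolding consistent_def written_ok_def by (simp add: fill_hole_def cong: if_cong)
  moreover have "stack_ok ?g" "buf_ok ?g" "cand_ok ?g" "unfilled_ok ?g"
    using g j unfolding consistent_defs fill_hole_def by auto
  ultimately show "consistent ?g" by (simp add: consistent_def)
  show "ancestors ?g \<noteq> []" using ne by (simp add: fill_hole_def)
  show "candidate ?g = None" using j by (simp add: fill_hole_def)
  show "hole_depth ?g i < length (ancestors ?g)" if "i \<in> {1..unfilled ?g}" for i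
    using unfilledD(7)[OF g ui, of i] that d by (auto simp: fill_hole_def)
qed

text \<open>As depths increase along the stack, one failed comparison with the topmost hole shows
  that no hole waits for the current node.\<close>

lemma consistent_pop_outside:
  assumes g: "consistent g" and s: "stack_size g = 0" and j: "candidate g = None"
    and ne: "ancestors g \<noteq> []"
    and d: "unfilled g > 0 \<Longrightarrow> hole_depth g (unfilled g) \<noteq> length (ancestors g)"
  shows "consistent (pop g)"
proof (rule consistent_pop[OF g ne])
  show "hole_depth g i < length (ancestors g)" if i: "i \<in> {1..unfilled g}" for i
  proof -
    have u: "unfilled g \<in> {1..unfilled g}" "unfilled g > 0" using i by auto
    have "hole_depth g (unfilled g) < length (ancestors g)"
      using unfilledD(3)[OF g u(1)] d[OF u(2)] by simp
    moreover have "hole_depth g i \<le> hole_depth g (unfilled g)"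
      using unfilledD(7)[OF g u(1), of i] i by (cases "i = unfilled g") auto
    ultimately show ?thesis by simp
  qed
qed (use j in simp)

section \<open>The end of a block in the ghost state\<close>

definition clear_block :: "'a ghost \<Rightarrow> 'a ghost" where
  "clear_block g = g\<lparr>buf_size := 0, stack_size := 0, candidate := None\<rparr>"

text \<open>The buffer has been copied to the output stream up to its cell \<open>i\<close>.\<close>

definition flush :: "nat \<Rightarrow> 'a ghost \<Rightarrow> 'a ghost" where
  "flush i g = (case candidate g of
       None \<Rightarrow> g
     | Some j \<Rightarrow> if j < i then store_hole (flushed g + j) g else g)
     \<lparr>flushed := flushed g + i,
      written := (\<lambda>k. if flushed g \<le> k \<and> k < flushed g + i \<and> candidate g \<noteq> Some (k - flushed g)
        then Some (ideal g ! k) else written g k)\<rparr>"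

text \<open>The clauses of \<open>cand_ok\<close> become those of \<open>unfilled_ok\<close> for the
  new top entry when the label stack is emptied. Its position lies behind all earlier holes, which
  are below \<open>flushed g\<close>.\<close>

lemma consistent_flush:
  assumes g: "consistent g"
  shows "consistent (clear_block (flush (buf_size g) g))"
proof (cases "candidate g")
  case None
  let ?g = "clear_block (flush (buf_size g) g)"
  have "written_ok ?g"
    using g None unfolding consistent_defs clear_block_def flush_def
    by (fastforce simp: fun_eq_iff)
  moreover have "stack_ok ?g" "buf_ok ?g" "cand_ok ?g" "unfilled_ok ?g"
    using g None unfolding consistent_defs clear_block_def flush_def by auto
  ultimately show ?thesis by (simp add: consistent_def)
next
  case (Some j)
  let ?g = "clear_block (flush (buf_size g) g)"
  have "cand_ok g" using g by (simp add: consistent_def)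
  then have c: "j < buf_size g" "stack_size g < length (ancestors g)"
      "ideal g ! (flushed g + j) = Closing (fst (ancestors g ! stack_size g))"
      "stack_size g = 0 \<longrightarrow> right_done g"
      "stack_size g > 0 \<longrightarrow> snd (ancestors g ! (stack_size g - 1)) = RightChild"
      "\<And>i. i \<in> {1..unfilled g} \<Longrightarrow> hole_depth g i < length (ancestors g) - stack_size g"
    using Some unfolding cand_ok_def by auto
  have w: "written_ok g" using g by (simp add: consistent_def)
  have "hole_pos ?g h < flushed ?g \<and> (\<forall>h'<h. hole_pos ?g h' < hole_pos ?g h)" if "h < holes ?g" for h
    using w Some c(1) that unfolding written_ok_def clear_block_def flush_def store_hole_def
    by (auto simp: less_Suc_eq intro: trans_less_add1)
  moreover have "label_cell ?g h = OutLetter (ideal ?g ! hole_pos ?g h) \<or>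
      (\<exists>i\<in>{1..unfilled ?g}. hole_id ?g i = h)" if "h < holes ?g" for h
  proof (cases "h = holes g")
    case True
    then show ?thesis using Some c(1)
      by (auto simp: clear_block_def flush_def store_hole_def intro!: bexI[of _ "Suc (unfilled g)"])
  next
    case False
    then have "h < holes g" using that Some c(1) by (simp add: clear_block_def flush_def store_hole_def)
    with w have "label_cell g h = OutLetter (ideal g ! hole_pos g h) \<or> (\<exists>i\<in>{1..unfilled g}. hole_id g i = h)"
      by (simp add: written_ok_def)
    then show ?thesis using False Some c(1)
      by (auto simp: clear_block_def flush_def store_hole_def)
        (metis Suc_n_not_le_n atLeastAtMost_iff le_SucI)
  qed
  moreover have "written ?g k = (if k < flushed ?g \<and> (\<forall>h<holes ?g. k \<noteq> hole_pos ?g h)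
       then Some (ideal ?g ! k) else None)" for k
    using w Some c(1) unfolding written_ok_def clear_block_def flush_def store_hole_def
    by (auto simp: less_Suc_eq)
  ultimately have "written_ok ?g" unfolding written_ok_def by blast
  moreover have "stack_ok ?g" "buf_ok ?g" "cand_ok ?g"
    using g Some c(1) unfolding consistent_defs clear_block_def flush_def store_hole_def by auto
  moreover have "unfilled_ok ?g"
    unfolding unfilled_ok_def
  proof (intro conjI ballI)
    have f: "unfilled ?g = Suc (unfilled g)" "holes ?g = Suc (holes g)" "stack_size ?g = 0"
        "ancestors ?g = ancestors g" "right_done ?g = right_done g" "ideal ?g = ideal g"
        "hole_id ?g = (hole_id g)(Suc (unfilled g) := holes g)"
        "hole_pos ?g = (hole_pos g)(holes g := flushed g + j)"
        "hole_depth ?g = (hole_depth g)(Suc (unfilled g) := length (ancestors g) - stack_size g)"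
      using Some c(1) by (simp_all add: clear_block_def flush_def store_hole_def)
    show "unfilled ?g \<le> holes ?g"
      using g by (simp add: f consistent_def unfilled_ok_def)
    fix i assume "i \<in> {1..unfilled ?g}"
    then consider "i = Suc (unfilled g)" | "i \<in> {1..unfilled g}" by (force simp: f)
    then have "hole_id ?g i < holes ?g \<and> 1 \<le> hole_depth ?g i \<and>
        hole_depth ?g i + stack_size ?g \<le> length (ancestors ?g) \<and>
        ideal ?g ! hole_pos ?g (hole_id ?g i) =
          Closing (fst (ancestors ?g ! (length (ancestors ?g) - hole_depth ?g i))) \<and>
        (hole_depth ?g i < length (ancestors ?g) \<longrightarrow>
          snd (ancestors ?g ! (length (ancestors ?g) - hole_depth ?g i - 1)) = RightChild) \<and>
        (hole_depth ?g i = length (ancestors ?g) \<longrightarrow> right_done ?g) \<and>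
        (\<forall>i'\<in>{1..<i}. hole_depth ?g i' < hole_depth ?g i)"
    proof cases
      case 1
      \<comment> \<open>An empty label stack gives the depth of the current node, whose flag is set;
        otherwise the ancestor just inside the one concerned has index
        \<open>stack_size g - 1\<close> and is a right child.\<close>
      then show ?thesis using c by (cases "stack_size g") (auto simp: f Suc_le_eq)
    next
      case 2
      then show ?thesis using unfilledD[OF g 2] by (auto simp: f)
    qed
    then show "hole_id ?g i < holes ?g" "1 \<le> hole_depth ?g i"
        "hole_depth ?g i + stack_size ?g \<le> length (ancestors ?g)"
        "ideal ?g ! hole_pos ?g (hole_id ?g i) =
          Closing (fst (ancestors ?g ! (length (ancestors ?g) - hole_depth ?g i)))"
        "hole_depth ?g i < length (ancestors ?g) \<longrightarrow>
          snd (ancestors ?g ! (length (ancestors ?g) - hole_depth ?g i - 1)) = RightChild"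
        "hole_depth ?g i = length (ancestors ?g) \<longrightarrow> right_done ?g"
        "\<And>i'. i' \<in> {1..<i} \<Longrightarrow> hole_depth ?g i' < hole_depth ?g i"
      by blast+
  qed
  ultimately show ?thesis by (simp add: consistent_def)
qed

lemma consistent_final:
  assumes g: "consistent g" and e: "ancestors g = []"
  shows "unfilled g = 0"
proof (rule ccontr)
  assume "unfilled g \<noteq> 0"
  then have "1 \<in> {1..unfilled g}" by simp
  from unfilledD(2,3)[OF g this] e show False by simp
qed

section \<open>The program\<close>

fun is_closing :: "(('a \<times> side) tag, 'a tag) letter \<Rightarrow> bool" where
  "is_closing (InLetter (Closing b)) = True"
| "is_closing _ = False"

fun is_closing_right :: "(('a \<times> side) tag, 'a tag) letter \<Rightarrow> bool" where
  "is_closing_right (InLetter (Closing b)) = (snd b = RightChild)"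
| "is_closing_right _ = False"

fun is_opening_left :: "(('a \<times> side) tag, 'a tag) letter \<Rightarrow> bool" where
  "is_opening_left (InLetter (Opening b)) = (snd b = LeftChild)"
| "is_opening_left _ = False"

fun opening_of :: "(('a \<times> side) tag, 'a tag) letter \<Rightarrow> (('a \<times> side) tag, 'a tag) letter" where
  "opening_of (InLetter (Opening b)) = OutLetter (Opening (fst b))"
| "opening_of _ = Blank"

fun closing_of :: "(('a \<times> side) tag, 'a tag) letter \<Rightarrow> (('a \<times> side) tag, 'a tag) letter" where
  "closing_of (InLetter (Opening b)) = OutLetter (Closing (fst b))"
| "closing_of (InLetter (Closing b)) = OutLetter (Closing (fst b))"
| "closing_of _ = Blank"

fun out_of :: "('i, 'o) letter \<Rightarrow> 'o" where
  "out_of (OutLetter z) = z"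

text \<open>Number cells: 0, 1 and 2 hold the constants 0, 1 and 3; 3 the top of the label stack; 4 the end of
  the buffer; 5 the candidate (0 if there is none); 6 three times the depth; 7 the top of the stack of
  unfilled holes; 8 the end of the table of holes; 9 the block number \<open>k\<close>; 10 and 11 \<open>floorlog 2 k\<close> and
  the power of 2 with this exponent; 12 the number of letters left in the block; 13 the output position;
  14 a loop variable; 15 the end-of-input flag; 16 scratch. Letter cells 0 and 1 hold the current and
  the previous letter. The arrays are interleaved modulo 3, so that all of them grow without being
  moved: \<open>represents\<close> below states where they are. The sentinel depth 0 in number cell 18 differs from
  the depth of any node.\<close>

definition prog :: "(('a \<times> side) tag, 'a tag) program" where
  "prog = [
    SetConst (Dir 1) 1,
    SetConst (Dir 2) 3,
    SetConst (Dir 4) 4,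
    SetConst (Dir 7) 18,
    SetConst (Dir 8) 20,
    SetConst (Dir 9) 1,
    SetConst (Dir 10) 1,
    SetConst (Dir 11) 2,
    SetConst (Dir 12) 1,
    \<comment> \<open>9: next letter\<close>
    JumpEq (Dir 12) (Dir 0) 47,
    ReadIn (Dir 0) 46,
    Arith Sub (Dir 12) (Dir 12) (Dir 1),
    JumpLetter is_closing (Dir 0) 27,
    JumpLetter is_opening_left (Dir 0) 20,
    JumpEq (Dir 3) (Dir 0) 17,
    MapLetter closing_of (Ind 4) (Ind 3),
    Jump 19,
    Arith Add (Dir 5) (Dir 4) (Dir 0),
    MapLetter (\<lambda>_. Blank) (Ind 4) (Dir 0),
    Arith Add (Dir 4) (Dir 4) (Dir 2),
    \<comment> \<open>20: opening tag\<close>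
    MapLetter opening_of (Ind 4) (Dir 0),
    Arith Add (Dir 4) (Dir 4) (Dir 2),
    Arith Add (Dir 3) (Dir 3) (Dir 2),
    MapLetter id (Ind 3) (Dir 0),
    Arith Add (Dir 6) (Dir 6) (Dir 2),
    MapLetter id (Dir 1) (Dir 0),
    Jump 9,
    \<comment> \<open>27: closing tag\<close>
    JumpLetter is_closing_right (Dir 1) 30,
    MapLetter closing_of (Ind 4) (Dir 0),
    Arith Add (Dir 4) (Dir 4) (Dir 2),
    JumpLess (Dir 0) (Dir 3) 34,
    JumpLess (Dir 0) (Dir 5) 36,
    JumpEq (Dir 6) (Ind 7) 39,
    Jump 43,
    Arith Sub (Dir 3) (Dir 3) (Dir 2),
    Jump 43,
    MapLetter closing_of (Ind 5) (Dir 0),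
    SetConst (Dir 5) 0,
    Jump 43,
    Arith Add (Dir 16) (Dir 7) (Dir 1),
    Arith Add (Dir 16) (Ind 16) (Dir 0),
    MapLetter closing_of (Ind 16) (Dir 0),
    Arith Sub (Dir 7) (Dir 7) (Dir 2),
    Arith Sub (Dir 6) (Dir 6) (Dir 2),
    MapLetter id (Dir 1) (Dir 0),
    Jump 9,
    \<comment> \<open>46: end of the input, 47: end of a block\<close>
    SetConst (Dir 15) 1,
    SetConst (Dir 14) 4,
    JumpEq (Dir 14) (Dir 4) 62,
    JumpLetter (\<lambda>a. a = Blank) (Ind 14) 52,
    WriteOut out_of (Ind 14),
    Jump 59,
    SkipOut,
    Arith Add (Ind 8) (Dir 13) (Dir 0),
    Arith Add (Dir 7) (Dir 7) (Dir 2),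
    Arith Sub (Ind 7) (Dir 6) (Dir 3),
    Arith Add (Dir 16) (Dir 7) (Dir 1),
    Arith Add (Ind 16) (Dir 8) (Dir 0),
    Arith Add (Dir 8) (Dir 8) (Dir 2),
    Arith Add (Dir 13) (Dir 13) (Dir 1),
    Arith Add (Dir 14) (Dir 14) (Dir 2),
    Jump 48,
    \<comment> \<open>62: the buffer has been flushed\<close>
    SetConst (Dir 3) 0,
    SetConst (Dir 4) 4,
    SetConst (Dir 5) 0,
    JumpEq (Dir 15) (Dir 1) 72,
    Arith Add (Dir 9) (Dir 9) (Dir 1),
    JumpLess (Dir 9) (Dir 11) 70,
    Arith Add (Dir 11) (Dir 11) (Dir 11),
    Arith Add (Dir 10) (Dir 10) (Dir 1),
    Arith Mul (Dir 12) (Dir 9) (Dir 10),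
    Jump 9,
    \<comment> \<open>72: second pass over the output stream\<close>
    RewindOut,
    SetConst (Dir 14) 20,
    SetConst (Dir 13) 0,
    JumpEq (Dir 14) (Dir 8) 84,
    JumpEq (Dir 13) (Ind 14) 80,
    ReadOut (Dir 0),
    Arith Add (Dir 13) (Dir 13) (Dir 1),
    Jump 75,
    WriteOut out_of (Ind 14),
    Arith Add (Dir 14) (Dir 14) (Dir 2),
    Arith Add (Dir 13) (Dir 13) (Dir 1),
    Jump 75]"

lemma length_prog: "length prog = 84"
  by (simp add: prog_def)

lemma prog_nth:
  "prog ! 0 = SetConst (Dir 1) 1"
  "prog ! 1 = SetConst (Dir 2) 3"
  "prog ! 2 = SetConst (Dir 4) 4"
  "prog ! 3 = SetConst (Dir 7) 18"
  "prog ! 4 = SetConst (Dir 8) 20"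
  "prog ! 5 = SetConst (Dir 9) 1"
  "prog ! 6 = SetConst (Dir 10) 1"
  "prog ! 7 = SetConst (Dir 11) 2"
  "prog ! 8 = SetConst (Dir 12) 1"
  "prog ! 9 = JumpEq (Dir 12) (Dir 0) 47"
  "prog ! 10 = ReadIn (Dir 0) 46"
  "prog ! 11 = Arith Sub (Dir 12) (Dir 12) (Dir 1)"
  "prog ! 12 = JumpLetter is_closing (Dir 0) 27"
  "prog ! 13 = JumpLetter is_opening_left (Dir 0) 20"
  "prog ! 14 = JumpEq (Dir 3) (Dir 0) 17"
  "prog ! 15 = MapLetter closing_of (Ind 4) (Ind 3)"
  "prog ! 16 = Jump 19"
  "prog ! 17 = Arith Add (Dir 5) (Dir 4) (Dir 0)"
  "prog ! 18 = MapLetter (\<lambda>_. Blank) (Ind 4) (Dir 0)"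
  "prog ! 19 = Arith Add (Dir 4) (Dir 4) (Dir 2)"
  "prog ! 20 = MapLetter opening_of (Ind 4) (Dir 0)"
  "prog ! 21 = Arith Add (Dir 4) (Dir 4) (Dir 2)"
  "prog ! 22 = Arith Add (Dir 3) (Dir 3) (Dir 2)"
  "prog ! 23 = MapLetter id (Ind 3) (Dir 0)"
  "prog ! 24 = Arith Add (Dir 6) (Dir 6) (Dir 2)"
  "prog ! 25 = MapLetter id (Dir 1) (Dir 0)"
  "prog ! 26 = Jump 9"
  "prog ! 27 = JumpLetter is_closing_right (Dir 1) 30"
  "prog ! 28 = MapLetter closing_of (Ind 4) (Dir 0)"
  "prog ! 29 = Arith Add (Dir 4) (Dir 4) (Dir 2)"
  "prog ! 30 = JumpLess (Dir 0) (Dir 3) 34"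
  "prog ! 31 = JumpLess (Dir 0) (Dir 5) 36"
  "prog ! 32 = JumpEq (Dir 6) (Ind 7) 39"
  "prog ! 33 = Jump 43"
  "prog ! 34 = Arith Sub (Dir 3) (Dir 3) (Dir 2)"
  "prog ! 35 = Jump 43"
  "prog ! 36 = MapLetter closing_of (Ind 5) (Dir 0)"
  "prog ! 37 = SetConst (Dir 5) 0"
  "prog ! 38 = Jump 43"
  "prog ! 39 = Arith Add (Dir 16) (Dir 7) (Dir 1)"
  "prog ! 40 = Arith Add (Dir 16) (Ind 16) (Dir 0)"
  "prog ! 41 = MapLetter closing_of (Ind 16) (Dir 0)"
  "prog ! 42 = Arith Sub (Dir 7) (Dir 7) (Dir 2)"
  "prog ! 43 = Arith Sub (Dir 6) (Dir 6) (Dir 2)"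
  "prog ! 44 = MapLetter id (Dir 1) (Dir 0)"
  "prog ! 45 = Jump 9"
  "prog ! 46 = SetConst (Dir 15) 1"
  "prog ! 47 = SetConst (Dir 14) 4"
  "prog ! 48 = JumpEq (Dir 14) (Dir 4) 62"
  "prog ! 49 = JumpLetter (\<lambda>a. a = Blank) (Ind 14) 52"
  "prog ! 50 = WriteOut out_of (Ind 14)"
  "prog ! 51 = Jump 59"
  "prog ! 52 = SkipOut"
  "prog ! 53 = Arith Add (Ind 8) (Dir 13) (Dir 0)"
  "prog ! 54 = Arith Add (Dir 7) (Dir 7) (Dir 2)"
  "prog ! 55 = Arith Sub (Ind 7) (Dir 6) (Dir 3)"
  "prog ! 56 = Arith Add (Dir 16) (Dir 7) (Dir 1)"
  "prog ! 57 = Arith Add (Ind 16) (Dir 8) (Dir 0)"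
  "prog ! 58 = Arith Add (Dir 8) (Dir 8) (Dir 2)"
  "prog ! 59 = Arith Add (Dir 13) (Dir 13) (Dir 1)"
  "prog ! 60 = Arith Add (Dir 14) (Dir 14) (Dir 2)"
  "prog ! 61 = Jump 48"
  "prog ! 62 = SetConst (Dir 3) 0"
  "prog ! 63 = SetConst (Dir 4) 4"
  "prog ! 64 = SetConst (Dir 5) 0"
  "prog ! 65 = JumpEq (Dir 15) (Dir 1) 72"
  "prog ! 66 = Arith Add (Dir 9) (Dir 9) (Dir 1)"
  "prog ! 67 = JumpLess (Dir 9) (Dir 11) 70"
  "prog ! 68 = Arith Add (Dir 11) (Dir 11) (Dir 11)"
  "prog ! 69 = Arith Add (Dir 10) (Dir 10) (Dir 1)"
  "prog ! 70 = Arith Mul (Dir 12) (Dir 9) (Dir 10)"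
  "prog ! 71 = Jump 9"
  "prog ! 72 = RewindOut"
  "prog ! 73 = SetConst (Dir 14) 20"
  "prog ! 74 = SetConst (Dir 13) 0"
  "prog ! 75 = JumpEq (Dir 14) (Dir 8) 84"
  "prog ! 76 = JumpEq (Dir 13) (Ind 14) 80"
  "prog ! 77 = ReadOut (Dir 0)"
  "prog ! 78 = Arith Add (Dir 13) (Dir 13) (Dir 1)"
  "prog ! 79 = Jump 75"
  "prog ! 80 = WriteOut out_of (Ind 14)"
  "prog ! 81 = Arith Add (Dir 14) (Dir 14) (Dir 2)"
  "prog ! 82 = Arith Add (Dir 13) (Dir 13) (Dir 1)"
  "prog ! 83 = Jump 75"
  by (simp_all add: prog_def)

text \<open>The position of a hole and its label share an address in the two arrays, so the pointer
  kept next to the depth serves both. The buffer starts at cell 4, which leaves 0 free to mean that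
  there is no candidate.\<close>

definition represents ::
  "(nat \<Rightarrow> nat) \<Rightarrow> (nat \<Rightarrow> (('a \<times> side) tag, 'a tag) letter) \<Rightarrow> 'a ghost \<Rightarrow> bool" where
  "represents n l g \<longleftrightarrow>
     n 0 = 0 \<and> n 1 = 1 \<and> n 2 = 3 \<and> n 3 = 3 * stack_size g \<and> n 4 = 4 + 3 * buf_size g \<and>
     n 5 = (case candidate g of None \<Rightarrow> 0 | Some j \<Rightarrow> 4 + 3 * j) \<and>
     n 6 = 3 * length (ancestors g) \<and> n 7 = 18 + 3 * unfilled g \<and> n 8 = 20 + 3 * holes g \<and>
     n 13 = flushed g \<and> n 18 = 0 \<and>
     (\<forall>h<holes g. n (20 + 3 * h) = hole_pos g h) \<and>
     (\<forall>i\<in>{1..unfilled g}. n (18 + 3 * i) = 3 * hole_depth g i \<and> n (19 + 3 * i) = 20 + 3 * hole_id g i) \<and>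
     (\<forall>j. l (3 + 3 * j) = stack_cell g (Suc j)) \<and> (\<forall>j. l (4 + 3 * j) = buf_cell g j) \<and>
     (\<forall>h. l (20 + 3 * h) = label_cell g h)"

lemma represents_unfilled:
  assumes "represents n l g" "i \<in> {1..unfilled g}"
  shows "n (18 + 3 * i) = 3 * hole_depth g i" "n (19 + 3 * i) = 20 + 3 * hole_id g i"
  using assms unfolding represents_def by blast+

definition used :: "(nat \<Rightarrow> nat) \<Rightarrow> nat" where
  "used n = n 9 * n 10 - n 12"

text \<open>Separates the interleaved arrays by their addresses modulo 3.\<close>

lemma mod3_neq:
  "3 * j \<noteq> Suc (3 * i)" "3 * j \<noteq> Suc (Suc (3 * i))" "Suc (3 * j) \<noteq> 3 * i" "Suc (Suc (3 * j)) \<noteq> 3 * i"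
  "16 + 3 * j \<noteq> 3 * i" "17 + 3 * j \<noteq> 3 * i" "3 * i \<noteq> 16 + 3 * j" "3 * i \<noteq> 17 + 3 * j"
  "4 + 3 * j \<noteq> 3 * i" "3 * i \<noteq> 4 + 3 * j"
  by presburger+

text \<open>\<open>M\<close> bounds the number of blocks. A factor 3 is the stride of the
  interleaved arrays, and one letter yields at most two tags, whence the 6 in front of the block
  length. Numbers must cover addresses, block lengths, output positions and three times the
  depth.\<close>

locale transcoder =
  fixes x :: "('a \<times> side) tag list" and y :: "'a tag list" and M E1 E2 w :: nat
  assumes matched_input: "matched [] False x"
    and emitted: "emits [] False x = y"
    and length_y: "length y \<le> length x"
    and blocks_le: "(\<Sum>i<k. i * floorlog 2 i) \<le> length x \<Longrightarrow> k \<le> M"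
    and E1: "24 + 3 * M \<le> E1"
    and E2: "30 + 6 * (M * floorlog 2 M) + 3 * M \<le> E2"
    and w: "40 + 6 * (M * floorlog 2 M) + 6 * M + 6 * length x \<le> w"
begin

section \<open>Program fragments for a single letter\<close>

abbreviation safe_from :: "nat \<Rightarrow> nat \<Rightarrow> (nat \<Rightarrow> nat) \<Rightarrow> (nat \<Rightarrow> (('a \<times> side) tag, 'a tag) letter) \<Rightarrow>
    nat \<Rightarrow> (nat \<Rightarrow> 'a tag option) \<Rightarrow> nat \<Rightarrow> nat \<Rightarrow> bool" where
  "safe_from \<equiv> safe prog x y E1 E2 w 200"

lemmas unfold_at = safe_unfold[where A = prog, unfolded length_prog]

text \<open>There is room for the cells that one more letter, or the end of the block, may need.\<close>

definition room :: "'a ghost \<Rightarrow> bool" where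
  "room g \<longleftrightarrow> 4 + 3 * stack_size g < E2 \<and> 7 + 3 * buf_size g < E2 \<and>
     24 + 3 * holes g \<le> E1 \<and> 24 + 3 * holes g \<le> E2 \<and> 24 + 3 * holes g \<le> w \<and>
     12 + 3 * stack_size g \<le> w \<and> 14 + 3 * buf_size g \<le> w \<and> 12 + 3 * length (ancestors g) \<le> w \<and>
     1 + flushed g + buf_size g \<le> w"

text \<open>The block bookkeeping and the end-of-input flag. Processing a letter after it has been
  counted, and copying the buffer, leave these cells alone, so \<open>block_ok\<close> carries
  over.\<close>

abbreviation control :: "nat set" where
  "control \<equiv> {9, 10, 11, 12, 15}"

text \<open>\<open>safe\<close> speaks of the whole remaining run, so a fragment is specified
  backwards: \<open>cont\<close> asks that every memory representing the updated ghost state be safe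
  at the line where the fragment ends. The other fragments follow this pattern.\<close>

lemma safe_opening:
  assumes r: "represents n l g" and b: "l 0 = InLetter (Opening b)" and t: "t \<le> 20" and rm: "room g"
    and cont: "\<And>n' l' t'. \<lbrakk>represents n' l' (emit (Opening (fst b)) (push b g));
      \<forall>a\<in>control. n' a = n a; l' (Suc 0) = InLetter (Opening b); t' \<le> 50\<rbrakk> \<Longrightarrow>
      safe_from t' 9 n' l' ip os op (Suc 0)"
  shows "safe_from t 20 n l ip os op (Suc 0)"
  using r rm b t
  apply (simp add: prog_nth unfold_at[where p=20]
     unfold_at[where p=21] unfold_at[where p=22] unfold_at[where p=23] unfold_at[where p=24]
     unfold_at[where p=25] unfold_at[where p=26] represents_def room_def)
  apply (rule cont)
     apply (simp_all add: represents_def emit_def push_def mod3_neq)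
  done

lemma safe_opening_right:
  assumes r: "represents n l g" and s: "stack_size g > 0" "stack_cell g (stack_size g) = InLetter (Opening p)"
    and b: "l 0 = InLetter (Opening b)" "snd b = RightChild" and t: "t \<le> 10" and rm: "room g"
    and cont: "\<And>n' l' t'. \<lbrakk>represents n' l' (emit (Closing (fst p)) g);
      \<forall>a\<in>control. n' a = n a; l' 0 = InLetter (Opening b); t' \<le> 20\<rbrakk> \<Longrightarrow>
      safe_from t' 20 n' l' ip os op (Suc 0)"
  shows "safe_from t 12 n l ip os op (Suc 0)"
proof -
  have "l (3 * stack_size g) = InLetter (Opening p)"
    using r s by (cases "stack_size g") (simp_all add: represents_def)
  then show ?thesis
    using r rm b t s
    apply (simp add: prog_nth unfold_at[where p=12]
       unfold_at[where p=13] unfold_at[where p=14] unfold_at[where p=15] unfold_at[where p=16]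
       unfold_at[where p=19] represents_def room_def)
    apply (rule cont)
       apply (simp_all add: represents_def emit_def mod3_neq)
    done
qed

lemma safe_opening_right_outside:
  assumes r: "represents n l g" and s: "stack_size g = 0"
    and b: "l 0 = InLetter (Opening b)" "snd b = RightChild" and t: "t \<le> 10" and rm: "room g"
    and cont: "\<And>n' l' t'. \<lbrakk>represents n' l' (emit_hole z g);
      \<forall>a\<in>control. n' a = n a; l' 0 = InLetter (Opening b); t' \<le> 20\<rbrakk> \<Longrightarrow>
      safe_from t' 20 n' l' ip os op (Suc 0)"
  shows "safe_from t 12 n l ip os op (Suc 0)"
  using r rm b t s
  apply (simp add: prog_nth unfold_at[where p=12]
     unfold_at[where p=13] unfold_at[where p=14] unfold_at[where p=17] unfold_at[where p=18]
     unfold_at[where p=19] represents_def room_def)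
  apply (rule cont)
     apply (simp_all add: represents_def emit_hole_def mod3_neq)
  done

lemma safe_opening_left:
  assumes b: "l 0 = InLetter (Opening b)" "snd b = LeftChild" and t: "t \<le> 10"
    and cont: "safe_from (t + 2) 20 n l ip os op (Suc 0)"
  shows "safe_from t 12 n l ip os op (Suc 0)"
  using b t cont
  by (simp add: prog_nth unfold_at[where p=12] unfold_at[where p=13])

lemma safe_closing_right_done:
  assumes b: "l 0 = InLetter (Closing b)" "is_closing_right (l (Suc 0))" and t: "t \<le> 10"
    and cont: "safe_from (t + 2) 30 n l ip os op (Suc 0)"
  shows "safe_from t 12 n l ip os op (Suc 0)"
  using b t cont
  by (simp add: prog_nth unfold_at[where p=12] unfold_at[where p=27])

lemma safe_closing_emit:
  assumes r: "represents n l g" and b: "l 0 = InLetter (Closing b)" "\<not> is_closing_right (l (Suc 0))"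
    and t: "t \<le> 10" and rm: "room g"
    and cont: "\<And>n' l' t'. \<lbrakk>represents n' l' (emit (Closing (fst b)) g);
      \<forall>a\<in>control. n' a = n a; l' 0 = InLetter (Closing b); t' \<le> 20\<rbrakk> \<Longrightarrow>
      safe_from t' 30 n' l' ip os op (Suc 0)"
  shows "safe_from t 12 n l ip os op (Suc 0)"
  using r rm b t
  apply (simp add: prog_nth unfold_at[where p=12] unfold_at[where p=27]
     unfold_at[where p=28] unfold_at[where p=29] represents_def room_def)
  apply (rule cont)
     apply (simp_all add: represents_def emit_def mod3_neq)
  done

lemma safe_pop:
  assumes r: "represents n l g" and b: "l 0 = InLetter (Closing b)" and t: "t \<le> 40" and rm: "room g"
    and s: "stack_size g = 0" and ne: "ancestors g \<noteq> []"
    and cont: "\<And>n' l' t'. \<lbrakk>represents n' l' (pop g);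
      \<forall>a\<in>control. n' a = n a; l' (Suc 0) = InLetter (Closing b); t' \<le> 50\<rbrakk> \<Longrightarrow>
      safe_from t' 9 n' l' ip os op (Suc 0)"
  shows "safe_from t 43 n l ip os op (Suc 0)"
proof -
  obtain c st where "ancestors g = c # st" using ne by (cases "ancestors g") auto
  then show ?thesis
    using r rm b t s
    apply (simp add: prog_nth unfold_at[where p=43] unfold_at[where p=44] unfold_at[where p=45]
       represents_def room_def)
    apply (rule cont)
       apply (simp_all add: represents_def pop_def mod3_neq)
    done
qed

lemma safe_pop_inside:
  assumes r: "represents n l g" and b: "l 0 = InLetter (Closing b)" and t: "t \<le> 30" and rm: "room g"
    and s: "stack_size g > 0" and ne: "ancestors g \<noteq> []"
    and cont: "\<And>n' l' t'. \<lbrakk>represents n' l' (pop g);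
      \<forall>a\<in>control. n' a = n a; l' (Suc 0) = InLetter (Closing b); t' \<le> 50\<rbrakk> \<Longrightarrow>
      safe_from t' 9 n' l' ip os op (Suc 0)"
  shows "safe_from t 30 n l ip os op (Suc 0)"
proof -
  obtain c st k where "ancestors g = c # st" "stack_size g = Suc k"
    using ne s by (cases "ancestors g"; cases "stack_size g") auto
  then show ?thesis
    using r rm b t
    apply (simp add: prog_nth unfold_at[where p=30] unfold_at[where p=34] unfold_at[where p=35]
       unfold_at[where p=43] unfold_at[where p=44] unfold_at[where p=45] represents_def room_def)
    apply (rule cont)
       apply (simp_all add: represents_def pop_def mod3_neq)
    done
qed

lemma safe_fill_candidate:
  assumes r: "represents n l g" and b: "l 0 = InLetter (Closing b)" and t: "t \<le> 30" and rm: "room g"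
    and s: "stack_size g = 0" and j: "candidate g = Some j" "j < buf_size g"
    and cont: "\<And>n' l' t'. \<lbrakk>represents n' l' (fill_candidate (Closing (fst b)) j g);
      \<forall>a\<in>control. n' a = n a; l' 0 = InLetter (Closing b); t' \<le> 40\<rbrakk> \<Longrightarrow>
      safe_from t' 43 n' l' ip os op (Suc 0)"
  shows "safe_from t 30 n l ip os op (Suc 0)"
proof -
  have "4 + 3 * j < E2" using rm j(2) by (simp add: room_def)
  then show ?thesis
    using r rm b t s j
    apply (simp add: prog_nth unfold_at[where p=30] unfold_at[where p=31] unfold_at[where p=36]
       unfold_at[where p=37] unfold_at[where p=38] represents_def room_def)
    apply (rule cont)
       apply (simp_all add: represents_def fill_candidate_def mod3_neq)
    done
qed

lemma safe_fill_hole: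
  assumes r: "represents n l g" and b: "l 0 = InLetter (Closing b)" and t: "t \<le> 30" and rm: "room g"
    and s: "stack_size g = 0" and j: "candidate g = None"
    and u: "unfilled g > 0" "hole_depth g (unfilled g) = length (ancestors g)"
      "unfilled g \<le> holes g" "hole_id g (unfilled g) < holes g"
    and cont: "\<And>n' l' t'. \<lbrakk>represents n' l' (fill_hole (Closing (fst b)) g);
      \<forall>a\<in>control. n' a = n a; l' 0 = InLetter (Closing b); t' \<le> 40\<rbrakk> \<Longrightarrow>
      safe_from t' 43 n' l' ip os op (Suc 0)"
  shows "safe_from t 30 n l ip os op (Suc 0)"
proof -
  obtain k where k: "unfilled g = Suc k" using u(1) by (cases "unfilled g") auto
  from represents_unfilled[OF r, of "unfilled g"]
  have n: "n (21 + 3 * k) = 3 * length (ancestors g)" "n (22 + 3 * k) = 20 + 3 * hole_id g (unfilled g)"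
    using u k by simp_all
  have sc: "n 0 = 0" "n (Suc 0) = 1" "n 2 = 3" "n 3 = 0" "n 5 = 0" "n 6 = 3 * length (ancestors g)" "n 7 = 21 + 3 * k"
    using r s j k by (simp_all add: represents_def)
  have b': "20 + 3 * hole_id g (unfilled g) < E2" "20 + 3 * hole_id g (unfilled g) \<le> w"
      "22 + 3 * k \<le> w" "24 \<le> E1"
    using rm u k by (auto simp: room_def)
  let ?n = "n(16 := 20 + 3 * hole_id g (unfilled g), 7 := 18 + 3 * k)"
  let ?l = "l(20 + 3 * hole_id g (unfilled g) := OutLetter (Closing (fst b)))"
  have "represents ?n ?l (fill_hole (Closing (fst b)) g)"
    using r unfolding represents_def fill_hole_def by (simp add: k mod3_neq)
  then have "safe_from (Suc (Suc (Suc (Suc (Suc (Suc (Suc t))))))) 43 ?n ?l ip os op (Suc 0)"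
    by (rule cont) (use b t in simp_all)
  then show ?thesis
    using n sc b' b t
    apply (simp add: prog_nth unfold_at[where p=30] unfold_at[where p=31] unfold_at[where p=32])
    apply (simp add: prog_nth unfold_at[where p=39] unfold_at[where p=40])
    apply (simp add: prog_nth unfold_at[where p=41] unfold_at[where p=42])
    done
qed

lemma safe_pop_outside:
  assumes r: "represents n l g" and t: "t \<le> 30"
    and s: "stack_size g = 0" and j: "candidate g = None" and ne: "ancestors g \<noteq> []"
    and u: "unfilled g > 0 \<Longrightarrow> hole_depth g (unfilled g) \<noteq> length (ancestors g)"
    and cont: "safe_from (Suc (Suc (Suc (Suc t)))) 43 n l ip os op (Suc 0)"
  shows "safe_from t 30 n l ip os op (Suc 0)"
proof -
  have "n (18 + 3 * unfilled g) \<noteq> 3 * length (ancestors g)"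
  proof (cases "unfilled g = 0")
    case True
    then show ?thesis using r ne by (simp add: represents_def)
  next
    case False
    then show ?thesis using represents_unfilled(1)[OF r, of "unfilled g"] u by simp
  qed
  then show ?thesis
    using r t s j cont
    by (simp add: prog_nth unfold_at[where p=30] unfold_at[where p=31] unfold_at[where p=32]
       unfold_at[where p=33] represents_def)
qed

end

section \<open>Flushing the buffer and the second pass\<close>

lemma flush_0: "flush 0 g = g"
  by (cases "candidate g") (auto simp: flush_def fun_eq_iff intro!: ghost.equality)

lemma flush_fields [simp]:
  "candidate (flush i g) = candidate g" "buf_size (flush i g) = buf_size g"
  "stack_size (flush i g) = stack_size g" "ancestors (flush i g) = ancestors g"
  "buf_cell (flush i g) = buf_cell g" "flushed (flush i g) = flushed g + i"
  "ideal (flush i g) = ideal g" "right_done (flush i g) = right_done g"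
  by (simp_all add: flush_def store_hole_def split: option.split)

lemma flush_Suc_write:
  "candidate g \<noteq> Some i \<Longrightarrow> flush (Suc i) g = (flush i g)\<lparr>flushed := Suc (flushed g + i),
     written := (written (flush i g))(flushed g + i := Some (ideal g ! (flushed g + i)))\<rparr>"
  by (cases "candidate g") (auto simp: flush_def store_hole_def fun_eq_iff less_Suc_eq)

lemma flush_Suc_skip:
  "candidate g = Some i \<Longrightarrow> flush (Suc i) g =
     store_hole (flushed g + i) ((flush i g)\<lparr>flushed := Suc (flushed g + i)\<rparr>)"
  by (intro ghost.equality) (auto simp: flush_def store_hole_def fun_eq_iff less_Suc_eq)

lemma flush_Suc_skip_before:
  "candidate g = Some i \<Longrightarrow> unfilled (flush i g) = unfilled g \<and> holes (flush i g) = holes g"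
  by (simp add: flush_def)

context transcoder
begin

text \<open>The rule \<open>safe.Arith\<close> with address and value already evaluated, so that a
  chain of writes to computed addresses is normalised one write at a time.\<close>

lemma safe_Arith:
  assumes "(prog :: (('a \<times> side) tag, 'a tag) program) ! p = Arith f d a b" "p < 84" "t < 200" "addr_of n d = A" "A < E1"
    "arith f (n (addr_of n a)) (n (addr_of n b)) = v" "v \<le> w" "Suc p = q"
    "safe_from (Suc t) q (n(A := v)) l ip os op ps"
  shows "safe_from t p n l ip os op ps"
proof (rule safe.Arith[OF _ assms(1,3)])
  show "p < length prog" using assms(2) by (simp add: length_prog)
qed (use assms(4-9) in \<open>simp_all only:\<close>)

lemma safe_flush_write:
  assumes r: "represents n l h" and i: "n 14 = 4 + 3 * i" "i < buf_size h"
    and z: "l (4 + 3 * i) = OutLetter z" and t: "t \<le> 150"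
    and bounds: "24 \<le> E1" "8 + 3 * i \<le> w" "Suc (flushed h) \<le> w"
    and cont: "\<And>n'. \<lbrakk>represents n' l (h\<lparr>flushed := Suc (flushed h), written := W\<rparr>);
      \<forall>a\<in>control. n' a = n a; n' 14 = 4 + 3 * Suc i\<rbrakk> \<Longrightarrow>
      safe_from (Suc (Suc (Suc (Suc 0)))) 48 n' l ip (os(op := Some z)) (Suc op) (Suc 0)"
  shows "safe_from t 48 n l ip os op (Suc 0)"
proof -
  let ?n = "n(13 := Suc (flushed h), 14 := 7 + 3 * i)"
  have "represents ?n l (h\<lparr>flushed := Suc (flushed h), written := W\<rparr>)"
    using r by (simp add: represents_def)
  then have "safe_from (Suc (Suc (Suc (Suc 0)))) 48 ?n l ip (os(op := Some z)) (Suc op) (Suc 0)"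
    by (rule cont) simp_all
  moreover have "n 0 = 0" "n (Suc 0) = Suc 0" "n 2 = 3" "n 4 = 4 + 3 * buf_size h" "n 13 = flushed h"
    using r by (simp_all add: represents_def)
  ultimately show ?thesis
    using i z t bounds
    apply (subst unfold_at)
    apply (simp add: prog_nth unfold_at[where p=49] unfold_at[where p=50] unfold_at[where p=51])
    apply (simp add: prog_nth unfold_at[where p=59] unfold_at[where p=60] unfold_at[where p=61])
    done
qed

text \<open>Skipping is no operation, so the clock runs on by the 12 steps of the loop body, whereas
  a write restarts it.\<close>

lemma safe_flush_skip:
  assumes r: "represents n l h" and i: "n 14 = 4 + 3 * i" "i < buf_size h"
    and z: "l (4 + 3 * i) = Blank" and t: "t \<le> 150"
    and bounds: "24 + 3 * holes h \<le> E1" "24 + 3 * holes h \<le> w" "unfilled h \<le> holes h"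
      "8 + 3 * i \<le> w" "Suc (flushed h) \<le> w" "3 * length (ancestors h) \<le> w"
    and cont: "\<And>n'. \<lbrakk>represents n' l (store_hole (flushed h) (h\<lparr>flushed := Suc (flushed h)\<rparr>));
      \<forall>a\<in>control. n' a = n a; n' 14 = 4 + 3 * Suc i\<rbrakk> \<Longrightarrow>
      safe_from (t + 12) 48 n' l ip os (Suc op) (Suc 0)"
  shows "safe_from t 48 n l ip os op (Suc 0)"
proof -
  let ?n = "n(20 + 3 * holes h := flushed h, 7 := 21 + 3 * unfilled h,
     21 + 3 * unfilled h := 3 * length (ancestors h) - 3 * stack_size h, 16 := 22 + 3 * unfilled h,
     22 + 3 * unfilled h := 20 + 3 * holes h, 8 := 23 + 3 * holes h,
     13 := Suc (flushed h), 14 := 7 + 3 * i)"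
  have "represents ?n l (store_hole (flushed h) (h\<lparr>flushed := Suc (flushed h)\<rparr>))"
    using r unfolding represents_def store_hole_def
    by (simp add: mod3_neq diff_mult_distrib2 atLeastAtMostSuc_conv)
  then have "safe_from (t + 12) 48 ?n l ip os (Suc op) (Suc 0)"
    by (rule cont) simp_all
  moreover have "t + 12 = Suc (Suc (Suc (Suc (Suc (Suc (Suc (Suc (Suc (Suc (Suc (Suc t)))))))))))"
    by simp
  ultimately have final: "safe_from (Suc (Suc (Suc (Suc (Suc (Suc (Suc (Suc (Suc (Suc (Suc (Suc t)))))))))))) 48
      ?n l ip os (Suc op) (Suc 0)"
    by (simp only:)
  have "n 0 = 0" "n (Suc 0) = Suc 0" "n 2 = 3" "n 3 = 3 * stack_size h"
      "n 4 = 4 + 3 * buf_size h" "n 6 = 3 * length (ancestors h)" "n 7 = 18 + 3 * unfilled h"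
      "n 8 = 20 + 3 * holes h" "n 13 = flushed h" "i \<noteq> buf_size h"
    using r i(2) by (simp_all add: represents_def)
  note eqs = this i(1) z
  have bnd: "22 + 3 * unfilled h < E1" "22 + 3 * unfilled h \<le> w" "23 + 3 * holes h < E1"
    "23 + 3 * holes h \<le> w" "3 * length (ancestors h) - 3 * stack_size h \<le> w" "16 < E1"
    using bounds by linarith+
  show ?thesis
    apply (subst unfold_at)
    apply (simp (no_asm) add: eqs prog_nth unfold_at[where p=49] unfold_at[where p=52])
    apply (intro conjI, (use t in \<open>simp; fail\<close>)+)
    apply (rule safe_Arith[where p = 53 and q = 54 and A = "20 + 3 * holes h" and v = "flushed h"], (use t bnd bounds(4,5) in \<open>simp add: prog_nth eqs; fail\<close>)+)
    apply (rule safe_Arith[where p = 54 and q = 55 and A = "7" and v = "21 + 3 * unfilled h"], (use t bnd bounds(4,5) in \<open>simp add: prog_nth eqs; fail\<close>)+)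
    apply (rule safe_Arith[where p = 55 and q = 56 and A = "21 + 3 * unfilled h" and v = "3 * length (ancestors h) - 3 * stack_size h"], (use t bnd bounds(4,5) in \<open>simp add: prog_nth eqs; fail\<close>)+)
    apply (rule safe_Arith[where p = 56 and q = 57 and A = "16" and v = "22 + 3 * unfilled h"], (use t bnd bounds(4,5) in \<open>simp add: prog_nth eqs; fail\<close>)+)
    apply (rule safe_Arith[where p = 57 and q = 58 and A = "22 + 3 * unfilled h" and v = "20 + 3 * holes h"], (use t bnd bounds(4,5) in \<open>simp add: prog_nth eqs; fail\<close>)+)
    apply (rule safe_Arith[where p = 58 and q = 59 and A = "8" and v = "23 + 3 * holes h"], (use t bnd bounds(4,5) in \<open>simp add: prog_nth eqs; fail\<close>)+)
    apply (rule safe_Arith[where p = 59 and q = 60 and A = "13" and v = "Suc (flushed h)"], (use t bnd bounds(4,5) in \<open>simp add: prog_nth eqs; fail\<close>)+)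
    apply (rule safe_Arith[where p = 60 and q = 61 and A = "14" and v = "7 + 3 * i"], (use t bnd bounds(4,5) in \<open>simp add: prog_nth eqs; fail\<close>)+)
    apply (simp (no_asm) add: prog_nth unfold_at[where p=61])
    apply (use t final in simp)
    done
qed

text \<open>Only one cell of a block can be a hole, so the clock runs on through a skip at most
  once; the allowance of 20 covers this. After a write the loop is reentered 4 steps later, hence
  \<open>4 \<le> c\<close>.\<close>

lemma safe_flush_loop:
  assumes g: "consistent g" and rm: "room g" and c: "4 \<le> c" "c \<le> 120"
    and cont: "\<And>n' t'. \<lbrakk>represents n' l (flush (buf_size g) g); \<forall>a\<in>control. n' a = n a; t' \<le> c + 21\<rbrakk> \<Longrightarrow>
      safe_from t' 62 n' l ip (written (flush (buf_size g) g)) (flushed g + buf_size g) (Suc 0)"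
  shows "\<lbrakk>i \<le> buf_size g; represents n' l (flush i g); \<forall>a\<in>control. n' a = n a; n' 14 = 4 + 3 * i;
      t \<le> (if \<exists>j<i. candidate g = Some j then c + 20 else c)\<rbrakk> \<Longrightarrow>
    safe_from t 48 n' l ip (written (flush i g)) (flushed g + i) (Suc 0)"
proof (induction "buf_size g - i" arbitrary: i n' t)
  case 0
  then have i: "i = buf_size g" by simp
  have "n' 4 = 4 + 3 * buf_size g" using 0 by (simp add: represents_def)
  moreover have "safe_from (Suc t) 62 n' l ip (written (flush i g)) (flushed g + i) (Suc 0)"
    using 0 unfolding i by (intro cont) (auto split: if_splits)
  moreover have "t \<le> 150" using 0(6) c by (simp split: if_splits)
  ultimately show ?case
    using 0(5) i by (subst unfold_at) (simp add: prog_nth)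
next
  case (Suc m)
  then have i: "i < buf_size g" by simp
  have lc: "l (4 + 3 * i) = buf_cell g i"
    using Suc.prems(2) by (simp add: represents_def)
  have bc: "buf_cell g i = (if candidate g = Some i then Blank else OutLetter (ideal g ! (flushed g + i)))"
    using g i by (simp add: consistent_def buf_ok_def)
  have b: "24 \<le> E1" "8 + 3 * i \<le> w" "Suc (flushed g + i) \<le> w" "3 * length (ancestors g) \<le> w"
    using rm i by (simp_all add: room_def)
  have t: "t \<le> 150" using Suc.prems c by (simp split: if_splits)
  show ?case
  proof (cases "candidate g = Some i")
    case True
    have u: "unfilled (flush i g) = unfilled g" "holes (flush i g) = holes g"
      using flush_Suc_skip_before[OF True] by auto
    have t': "t \<le> c" using Suc.prems True by simp
    show ?thesis
    proof (rule safe_flush_skip[OF Suc.prems(2,4) _ _ t])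
      show "l (4 + 3 * i) = Blank" using lc bc True by simp
      show "unfilled (flush i g) \<le> holes (flush i g)"
        using g by (simp add: u consistent_def unfilled_ok_def)
      fix n''
      assume *: "represents n'' l (store_hole (flushed (flush i g))
          ((flush i g)\<lparr>flushed := Suc (flushed (flush i g))\<rparr>))"
        "\<forall>a\<in>control. n'' a = n' a" "n'' 14 = 4 + 3 * Suc i"
      have W: "written (flush (Suc i) g) = written (flush i g)"
        by (simp add: flush_Suc_skip[OF True] store_hole_def)
      have "safe_from (t + 12) 48 n'' l ip (written (flush (Suc i) g)) (flushed g + Suc i) (Suc 0)"
      proof (rule Suc.hyps(1))
        show "represents n'' l (flush (Suc i) g)" using *(1) flush_Suc_skip[OF True] by simp
        show "\<forall>a\<in>control. n'' a = n a" using *(2) Suc.prems(3) by simp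
      qed (use Suc.hyps(2) i * t' True in auto)
      then show "safe_from (t + 12) 48 n'' l ip (written (flush i g)) (Suc (flushed g + i)) (Suc 0)"
        by (simp add: W)
    qed (use b i rm u in \<open>simp_all add: room_def\<close>)
  next
    case False
    let ?W = "(written (flush i g))(flushed g + i := Some (ideal g ! (flushed g + i)))"
    show ?thesis
    proof (rule safe_flush_write[OF Suc.prems(2,4) _ _ t, where W = ?W])
      show "l (4 + 3 * i) = OutLetter (ideal g ! (flushed g + i))" using lc bc False by simp
      fix n''
      assume *: "represents n'' l ((flush i g)\<lparr>flushed := Suc (flushed (flush i g)), written := ?W\<rparr>)"
        "\<forall>a\<in>control. n'' a = n' a" "n'' 14 = 4 + 3 * Suc i"
      have W: "written (flush (Suc i) g) = ?W"
        by (simp add: flush_Suc_write[OF False])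
      have "safe_from (Suc (Suc (Suc (Suc 0)))) 48 n'' l ip (written (flush (Suc i) g)) (flushed g + Suc i) (Suc 0)"
      proof (rule Suc.hyps(1))
        show "represents n'' l (flush (Suc i) g)" using *(1) flush_Suc_write[OF False] by simp
        show "\<forall>a\<in>control. n'' a = n a" using *(2) Suc.prems(3) by simp
      qed (use Suc.hyps(2) i * c in auto)
      then show "safe_from (Suc (Suc (Suc (Suc 0)))) 48 n'' l ip ?W (Suc (flushed g + i)) (Suc 0)"
        by (simp add: W)
    qed (use b i in simp_all)
  qed
qed

lemma safe_flush:
  assumes g: "consistent g" and rm: "room g" and r: "represents n l g" and t: "t \<le> 110"
    and cont: "\<And>n' t'. \<lbrakk>represents n' l (clear_block (flush (buf_size g) g)); \<forall>a\<in>control. n' a = n a;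
      t' \<le> t + 30\<rbrakk> \<Longrightarrow>
      safe_from t' 65 n' l ip (written (flush (buf_size g) g)) (flushed g + buf_size g) (Suc 0)"
  shows "safe_from t 47 n l ip (written g) (flushed g) (Suc 0)"
proof -
  have "safe_from (Suc t) 48 (n(14 := 4)) l ip (written (flush 0 g)) (flushed g + 0) (Suc 0)"
  \<comment> \<open>\<open>t + 5\<close> is at least 4 and covers the step that initialises the loop
    variable.\<close>
  proof (rule safe_flush_loop[OF g rm, where c = "t + 5"])
    show "represents (n(14 := 4)) l (flush 0 g)"
      using r unfolding flush_0 by (simp add: represents_def)
    fix n' :: "nat \<Rightarrow> nat" and t' :: nat
    assume *: "represents n' l (flush (buf_size g) g)" "\<forall>a\<in>control. n' a = n a" "t' \<le> t + 5 + 21"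
    let ?n = "n'(3 := 0, 4 := 4, 5 := 0)"
    have "represents ?n l (clear_block (flush (buf_size g) g))"
      using *(1) by (simp add: represents_def clear_block_def)
    then have "safe_from (Suc (Suc (Suc t'))) 65 ?n l ip (written (flush (buf_size g) g))
        (flushed g + buf_size g) (Suc 0)"
      by (rule cont) (use * in simp_all)
    then show "safe_from t' 62 n' l ip (written (flush (buf_size g) g)) (flushed g + buf_size g) (Suc 0)"
      using rm *(3) t
      by (simp add: prog_nth unfold_at[where p=62] unfold_at[where p=63] unfold_at[where p=64] room_def)
  qed (use t in simp_all)
  then show ?thesis
    using t rm by (simp add: prog_nth unfold_at[where p=47] flush_0 room_def)
qed

text \<open>Each round performs an operation: a hole is written, and any other cell passed is read,
  as \<open>SkipOut\<close> would let the clock run on. Reading overwrites letter cell 0, so only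
  the label cells of \<open>l'\<close> are tied to \<open>l\<close>. The loop stops after the last
  hole rather than at the end of the stream.\<close>

lemma safe_second_pass_loop:
  assumes hp: "\<forall>h<H. pos h < length y \<and> (\<forall>h'<h. pos h' < pos h)"
    and ll: "\<forall>h<H. l (20 + 3 * h) = OutLetter (y ! pos h)"
    and b: "24 + 3 * H \<le> w" "24 \<le> E1" "2 \<le> E2" "length y < w"
  shows "\<lbrakk>h \<le> H; n 1 = 1; n 2 = 3; n 8 = 20 + 3 * H; \<forall>h<H. n (20 + 3 * h) = pos h;
      n 14 = 20 + 3 * h; n 13 = k; \<forall>h'<h. pos h' < k; \<forall>h'<H. h \<le> h' \<longrightarrow> k \<le> pos h'; t \<le> 160;
      os = (\<lambda>i. if i < length y \<and> (\<forall>h'<H. h \<le> h' \<longrightarrow> i \<noteq> pos h') then Some (y ! i) else None);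
      \<forall>h<H. l' (20 + 3 * h) = l (20 + 3 * h)\<rbrakk> \<Longrightarrow>
    safe_from t 75 n l' ip os k 2"
proof (induction "(length y - k) + (H - h)" arbitrary: h n k t os l' rule: less_induct)
  case less
  note prems = less.prems
  show ?case
  proof (cases "h = H")
    case True
    then have "n 14 = n 8" using prems by simp
    moreover have "os = (\<lambda>i. if i < length y then Some (y ! i) else None)"
      using prems(11) True by (auto simp: fun_eq_iff)
    ultimately show ?thesis
      using prems by (subst unfold_at) (simp add: prog_nth unfold_at[where p=84])
  next
    case False
    then have h: "h < H" using prems by simp
    then have ph: "pos h < length y" "k \<le> pos h" using hp prems(9) by auto
    have n: "n (20 + 3 * h) = pos h" "n (Suc 0) = 1" using prems h by simp_all
    have lb: "l' (20 + 3 * h) = OutLetter (y ! pos h)" using prems(12) ll h by simp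
    have hh: "pos h < pos h'" if "h < h'" "h' < H" for h' using hp that by blast
    show ?thesis
    proof (cases "k = pos h")
      case True
      let ?os = "os(pos h := Some (y ! pos h))"
      let ?n = "n(14 := 23 + 3 * h, 13 := Suc (pos h))"
      have "safe_from (Suc (Suc (Suc 0))) 75 ?n l' ip ?os (Suc k) 2"
      proof (rule less.hyps)
        show "?os = (\<lambda>i. if i < length y \<and> (\<forall>h'<H. Suc h \<le> h' \<longrightarrow> i \<noteq> pos h') then Some (y ! i) else None)"
        proof
          fix i
          have "(\<forall>h'<H. h \<le> h' \<longrightarrow> i \<noteq> pos h') \<longleftrightarrow> i \<noteq> pos h \<and> (\<forall>h'<H. Suc h \<le> h' \<longrightarrow> i \<noteq> pos h')"
            using h by (auto simp: Suc_le_eq le_less)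
          moreover have "\<forall>h'<H. Suc h \<le> h' \<longrightarrow> pos h \<noteq> pos h'"
            using hh by (metis Suc_le_eq less_irrefl)
          ultimately show "?os i = (if i < length y \<and> (\<forall>h'<H. Suc h \<le> h' \<longrightarrow> i \<noteq> pos h')
              then Some (y ! i) else None)"
            using prems(11) ph by (cases "i = pos h") simp_all
        qed
        show "\<forall>h'<Suc h. pos h' < Suc k" using prems(8) True by (auto simp: less_Suc_eq)
        show "\<forall>h'<H. Suc h \<le> h' \<longrightarrow> Suc k \<le> pos h'" using hh True by (auto simp: Suc_le_eq)
      qed (use prems h True ph in auto)
      then show ?thesis
        using prems(1-7,10) n lb h True b ph
        apply (subst unfold_at)
        apply (simp add: prog_nth unfold_at[where p=76] unfold_at[where p=80])
        apply (simp add: prog_nth unfold_at[where p=81] unfold_at[where p=82] unfold_at[where p=83])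
        done
    next
      case False
      then have k: "k < pos h" "k < length y" using ph by auto
      have kp: "k < pos h'" if "h' < H" "h \<le> h'" for h'
        using hh[of h'] that k by (cases "h' = h") auto
      then have os: "os k = Some (y ! k)" using prems(11) k by auto
      let ?n = "n(13 := Suc k)"
      let ?l = "l'(0 := OutLetter (y ! k))"
      have "safe_from (Suc (Suc 0)) 75 ?n ?l ip os (Suc k) 2"
      proof (rule less.hyps)
        show "\<forall>h'<h. pos h' < Suc k" using prems(8) by (auto simp: less_Suc_eq)
        show "\<forall>h'<H. h \<le> h' \<longrightarrow> Suc k \<le> pos h'" using kp by (auto simp: Suc_le_eq)
      qed (use prems h False k in auto)
      then show ?thesis
        using prems(1-7,10) n h False b k os
        apply (subst unfold_at)
        apply (simp add: prog_nth unfold_at[where p=76] unfold_at[where p=77])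
        apply (simp add: prog_nth unfold_at[where p=78] unfold_at[where p=79])
        done
    qed
  qed
qed

lemma safe_second_pass:
  assumes g: "consistent g" and e: "ancestors g = []" and f: "flushed g = length y" "ideal g = y"
    and r: "represents n l g" and b: "24 + 3 * holes g \<le> w" "24 \<le> E1" "2 \<le> E2" "length y < w"
    and t: "t \<le> 150"
  shows "safe_from t 72 n l ip (written g) op (Suc 0)"
proof -
  have u: "unfilled g = 0" by (rule consistent_final[OF g e])
  have w: "written_ok g" using g by (simp add: consistent_def)
  have "safe_from (Suc (Suc (Suc t))) 75 (n(14 := 20, 13 := 0)) l ip (written g) 0 2"
  proof (rule safe_second_pass_loop[where H = "holes g" and pos = "hole_pos g" and l = l and h = 0])
    show "\<forall>h<holes g. hole_pos g h < length y \<and> (\<forall>h'<h. hole_pos g h' < hole_pos g h)"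
      using w f by (simp add: written_ok_def)
    show "\<forall>h<holes g. l (20 + 3 * h) = OutLetter (y ! hole_pos g h)"
      using w f u r by (simp add: written_ok_def represents_def)
    show "written g = (\<lambda>i. if i < length y \<and> (\<forall>h'<holes g. 0 \<le> h' \<longrightarrow> i \<noteq> hole_pos g h')
        then Some (y ! i) else None)"
      using w f by (simp add: written_ok_def cong: if_cong)
  qed (use b t r in \<open>simp_all add: represents_def\<close>)
  then show ?thesis
    using b t
    by (simp add: prog_nth unfold_at[where p=72] unfold_at[where p=73] unfold_at[where p=74] numeral_2_eq_2)
qed

end

section \<open>Correctness of the program\<close>

text \<open>Justifies the incremental computation: the binary length grows exactly when the block
  number reaches the stored power of 2, which is then doubled.\<close>

lemma floorlog_Suc_eq:
  assumes "k > 0"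
  shows "floorlog 2 (Suc k) = (if Suc k < 2 ^ floorlog 2 k then floorlog 2 k else Suc (floorlog 2 k))"
    and "\<not> Suc k < 2 ^ floorlog 2 k \<Longrightarrow> Suc k = 2 ^ floorlog 2 k"
proof -
  have b: "k < 2 ^ floorlog 2 k" using floorlog_bounds[of k 2] assms by simp
  show e: "Suc k = 2 ^ floorlog 2 k" if "\<not> Suc k < 2 ^ floorlog 2 k" using that b by simp
  have m: "floorlog 2 k \<le> floorlog 2 (Suc k)" by (intro floorlog_mono) simp
  show "floorlog 2 (Suc k) = (if Suc k < 2 ^ floorlog 2 k then floorlog 2 k else Suc (floorlog 2 k))"
  proof (cases "Suc k < 2 ^ floorlog 2 k")
    case True
    then have "floorlog 2 (Suc k) \<le> floorlog 2 k" by (intro floorlog_leI) auto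
    with m True show ?thesis by simp
  next
    case False
    have "floorlog 2 (1 * 2 ^ floorlog 2 k) = floorlog 2 1 + floorlog 2 k"
      by (rule floorlog_power) auto
    moreover have "floorlog 2 1 = (1 :: nat)" by (simp add: floorlog_def)
    ultimately show ?thesis using False e by simp
  qed
qed

lemma two_power_floorlog_le: "k > 0 \<Longrightarrow> 2 ^ floorlog 2 k \<le> 2 * k"
  using floorlog_bounds[of k 2] floorlog_eq_zero_iff[of 2 k]
  by (cases "floorlog 2 k") auto

text \<open>The number of letters before block \<open>k\<close>; the blocks are numbered from 1, and
  the term for 0 vanishes.\<close>

definition block_sum :: "nat \<Rightarrow> nat" where
  "block_sum k = (\<Sum>i<k. i * floorlog 2 i)"

lemma block_sum_Suc: "block_sum (Suc k) = block_sum k + k * floorlog 2 k"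
  by (simp add: block_sum_def)

definition block_ok :: "nat \<Rightarrow> (nat \<Rightarrow> nat) \<Rightarrow> bool" where
  "block_ok ip n \<longleftrightarrow> 1 \<le> n 9 \<and> n 10 = floorlog 2 (n 9) \<and> n 11 = 2 ^ floorlog 2 (n 9) \<and>
     n 12 \<le> n 9 * n 10 \<and> block_sum (n 9) + used n = ip \<and> n 15 = 0"

lemma block_ok_cong: "\<lbrakk>block_ok ip n; \<forall>a\<in>{9, 10, 11, 12, 15}. n' a = n a\<rbrakk> \<Longrightarrow> block_ok ip n'"
  by (auto simp: block_ok_def used_def)

section \<open>The main loop\<close>

context transcoder
begin

lemma block_bounds:
  assumes "block_ok ip n" "ip \<le> length x"
  shows "n 9 \<le> M" "n 9 * n 10 \<le> M * floorlog 2 M" "used n \<le> M * floorlog 2 M"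
proof -
  show m: "n 9 \<le> M"
    using assms by (intro blocks_le) (simp add: block_ok_def block_sum_def)
  show z: "n 9 * n 10 \<le> M * floorlog 2 M"
    using assms m by (auto simp: block_ok_def intro!: mult_le_mono floorlog_mono)
  show "used n \<le> M * floorlog 2 M"
    using z by (simp add: used_def)
qed

text \<open>Each completed block left at most one hole, and a letter pushes at most one label and
  emits at most two tags. Correctness looks ahead: the ideal output so far, continued by what the
  rest of the input emits, is \<open>y\<close>.\<close>

definition invariant :: "nat \<Rightarrow> (nat \<Rightarrow> nat) \<Rightarrow> 'a ghost \<Rightarrow> bool" where
  "invariant ip n g \<longleftrightarrow> consistent g \<and> block_ok ip n \<and> ip \<le> length x \<and> length (ancestors g) \<le> ip \<and>
     holes g < n 9 \<and> stack_size g \<le> used n \<and> buf_size g \<le> 2 * used n \<and>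
     matched (ancestors g) (right_done g) (drop ip x) \<and>
     ideal g @ emits (ancestors g) (right_done g) (drop ip x) = y"

lemma roomI:
  assumes "flushed g + buf_size g = length (ideal g)" "holes g \<le> M" "stack_size g \<le> M * floorlog 2 M"
    "buf_size g \<le> 2 * (M * floorlog 2 M)" "length (ancestors g) \<le> length x"
    "length (ideal g) \<le> length x"
  shows "room g"
  using assms E1 E2 w unfolding room_def by linarith

lemma invariant_room:
  assumes "invariant ip n g"
  shows "room g"
proof (rule roomI)
  have b: "block_ok ip n" "ip \<le> length x" using assms by (simp_all add: invariant_def)
  note bb = block_bounds[OF b]
  show "flushed g + buf_size g = length (ideal g)"
    using assms by (simp add: invariant_def consistent_def buf_ok_def)
  show "holes g \<le> M" "stack_size g \<le> M * floorlog 2 M" "buf_size g \<le> 2 * (M * floorlog 2 M)"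
      "length (ancestors g) \<le> length x"
    using assms bb by (auto simp: invariant_def)
  have "length (ideal g) \<le> length y" using assms by (auto simp: invariant_def)
  then show "length (ideal g) \<le> length x" using length_y by simp
qed

lemma safe_read:
  assumes r: "represents n l g" and ip: "ip < length x" and m: "n 12 > 0" "n 12 \<le> w"
    and t: "t \<le> 95" and b: "24 \<le> E1" "2 \<le> E2"
    and cont: "\<lbrakk>represents (n(12 := n 12 - 1)) (l(0 := InLetter (x ! ip))) g\<rbrakk> \<Longrightarrow>
      safe_from (Suc 0) 12 (n(12 := n 12 - 1)) (l(0 := InLetter (x ! ip))) (Suc ip) os op (Suc 0)"
  shows "safe_from t 9 n l ip os op (Suc 0)"
proof -
  have "represents (n(12 := n 12 - 1)) (l(0 := InLetter (x ! ip))) g"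
    using r by (simp add: represents_def)
  then have s: "safe_from (Suc 0) 12 (n(12 := n 12 - Suc 0)) (l(0 := InLetter (x ! ip))) (Suc ip) os op (Suc 0)"
    using cont by simp
  have "n 0 = 0" "n (Suc 0) = 1" using r by (simp_all add: represents_def)
  then show ?thesis
    using s ip m t b
    by (subst unfold_at) (simp add: prog_nth unfold_at[where p=10] unfold_at[where p=11])
qed

lemma safe_end_of_input:
  assumes r: "represents n l g" and ip: "ip = length x" and m: "n 12 > 0"
    and t: "t \<le> 95" and b: "24 \<le> E1" "2 \<le> E2" "1 \<le> w"
    and cont: "safe_from (Suc (Suc (Suc t))) 47 (n(15 := 1)) l ip os op (Suc 0)"
  shows "safe_from t 9 n l ip os op (Suc 0)"
proof -
  have "n 0 = 0" "n (Suc 0) = 1" using r by (simp_all add: represents_def)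
  then show ?thesis
    using cont ip m t b
    by (subst unfold_at) (simp add: prog_nth unfold_at[where p=10] unfold_at[where p=46])
qed

lemma safe_next_block:
  assumes r: "represents n l g" and k: "n 9 = k" "n 10 = floorlog 2 k" "n 11 = 2 ^ floorlog 2 k"
      "n 15 = 0" "1 \<le> k"
    and b: "Suc k \<le> w" "2 * 2 ^ floorlog 2 k \<le> w" "Suc (floorlog 2 k) \<le> w"
      "Suc k * floorlog 2 (Suc k) \<le> w" "24 \<le> E1" and t: "t \<le> 150"
    and cont: "\<And>n' t'. \<lbrakk>represents n' l g; n' 9 = Suc k; n' 10 = floorlog 2 (Suc k);
      n' 11 = 2 ^ floorlog 2 (Suc k); n' 12 = Suc k * floorlog 2 (Suc k); n' 15 = 0; t' \<le> t + 10\<rbrakk> \<Longrightarrow>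
      safe_from t' 9 n' l ip os op (Suc 0)"
  shows "safe_from t 65 n l ip os op (Suc 0)"
proof -
  have sc: "n 0 = 0" "n (Suc 0) = 1" using r by (simp_all add: represents_def)
  have k0: "k > 0" using k by simp
  show ?thesis
  proof (cases "Suc k < 2 ^ floorlog 2 k")
    case True
    let ?n = "n(9 := Suc k, 12 := Suc k * floorlog 2 k)"
    have f: "floorlog 2 (Suc k) = floorlog 2 k" using floorlog_Suc_eq(1)[OF k0] True by simp
    have "safe_from (Suc (Suc (Suc (Suc (Suc t))))) 9 ?n l ip os op (Suc 0)"
      using r k f by (intro cont) (simp_all add: represents_def)
    moreover have "floorlog 2 k + k * floorlog 2 k \<le> w" using b(4) f by simp
    ultimately show ?thesis
      using sc k b t True
      apply (simp add: prog_nth unfold_at[where p=65] unfold_at[where p=66] unfold_at[where p=67])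
      apply (simp add: prog_nth unfold_at[where p=70] unfold_at[where p=71])
      done
  next
    case False
    let ?n = "n(9 := Suc k, 11 := 2 ^ floorlog 2 k + 2 ^ floorlog 2 k, 10 := Suc (floorlog 2 k),
      12 := Suc k * Suc (floorlog 2 k))"
    have f: "floorlog 2 (Suc k) = Suc (floorlog 2 k)" using floorlog_Suc_eq(1)[OF k0] False by simp
    have "safe_from (Suc (Suc (Suc (Suc (Suc (Suc (Suc t))))))) 9 ?n l ip os op (Suc 0)"
      using r k f by (intro cont) (simp_all add: represents_def)
    moreover have "Suc k * Suc (floorlog 2 k) \<le> w" using b(4) f by simp
    ultimately show ?thesis
      using sc k b t False
      apply (simp add: prog_nth unfold_at[where p=65] unfold_at[where p=66] unfold_at[where p=67])
      apply (simp add: prog_nth unfold_at[where p=68] unfold_at[where p=69])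
      apply (simp add: prog_nth unfold_at[where p=70] unfold_at[where p=71] add.left_commute)
      done
  qed
qed

lemma E_bounds: "24 \<le> E1" "2 \<le> E2" "24 \<le> w"
  using E1 E2 w by linarith+

text \<open>The new block is nonempty, so two block ends never follow each other without a letter in
  between.\<close>

lemma safe_block_end:
  assumes inv: "invariant ip n g" and r: "represents n l g" and z: "n 12 = 0" and t: "t \<le> 50"
    and cont: "\<And>n' t' g'. \<lbrakk>invariant ip n' g'; represents n' l g'; right_done g' = right_done g; n' 12 > 0;
      t' \<le> 95\<rbrakk> \<Longrightarrow> safe_from t' 9 n' l ip (written g') (flushed g') (Suc 0)"
  shows "safe_from t 9 n l ip (written g) (flushed g) (Suc 0)"
proof -
  define k where "k = n 9"
  define g' where "g' = clear_block (flush (buf_size g) g)"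
  have g: "consistent g" and bk: "block_ok ip n" and ip: "ip \<le> length x" using inv by (simp_all add: invariant_def)
  have rm: "room g" by (rule invariant_room[OF inv])
  have sc: "n 0 = 0" using r by (simp add: represents_def)
  have k1: "1 \<le> k" "n 10 = floorlog 2 k" "n 11 = 2 ^ floorlog 2 k" "n 15 = 0"
    using bk by (simp_all add: block_ok_def k_def)
  have bs: "block_sum (Suc k) = ip"
    using bk z by (auto simp: block_ok_def used_def k_def block_sum_Suc)
  \<comment> \<open>Block \<open>k\<close> has been read completely, so the next block also starts
    within the input and its number is still bounded by \<open>M\<close>.\<close>
  then have M: "Suc k \<le> M" using ip by (intro blocks_le) (simp add: block_sum_def)
  have fl: "floorlog 2 (Suc k) \<le> floorlog 2 M" by (rule floorlog_mono[OF M])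
  have p2: "2 ^ floorlog 2 k \<le> 2 * k" using k1 by (intro two_power_floorlog_le) simp
  have "floorlog 2 k \<le> k"
    using k1 p2 less_exp[of "floorlog 2 k"] by (intro floorlog_leI) (auto intro: less_exp)
  then have bnd: "Suc k \<le> w" "2 * 2 ^ floorlog 2 k \<le> w" "Suc (floorlog 2 k) \<le> w"
      "Suc k * floorlog 2 (Suc k) \<le> w"
    using w M p2 mult_le_mono[OF M fl] by linarith+
  have f: "floorlog 2 (Suc k) > 0" using floorlog_eq_zero_iff[of 2 "Suc k"] by simp
  have "safe_from (Suc t) 47 n l ip (written g) (flushed g) (Suc 0)"
  proof (rule safe_flush[OF g rm r])
    fix n' :: "nat \<Rightarrow> nat" and t' :: nat
    assume *: "represents n' l (clear_block (flush (buf_size g) g))" "\<forall>a\<in>control. n' a = n a" "t' \<le> Suc t + 30"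
    have fields: "written g' = written (flush (buf_size g) g)" "flushed g' = flushed g + buf_size g"
      "ancestors g' = ancestors g" "right_done g' = right_done g" "ideal g' = ideal g"
      "stack_size g' = 0" "buf_size g' = 0" "holes g' \<le> Suc (holes g)"
      by (simp_all add: g'_def clear_block_def) (simp add: flush_def store_hole_def split: option.split)
    have "safe_from t' 65 n' l ip (written g') (flushed g') (Suc 0)"
    proof (rule safe_next_block)
      show "represents n' l g'" using * by (simp add: g'_def)
      show "n' 9 = k" "n' 10 = floorlog 2 k" "n' 11 = 2 ^ floorlog 2 k" "n' 15 = 0"
        using * k1 by (simp_all add: k_def)
      fix n'' :: "nat \<Rightarrow> nat" and t'' :: nat
      assume **: "represents n'' l g'" "n'' 9 = Suc k" "n'' 10 = floorlog 2 (Suc k)"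
        "n'' 11 = 2 ^ floorlog 2 (Suc k)" "n'' 12 = Suc k * floorlog 2 (Suc k)" "n'' 15 = 0" "t'' \<le> t' + 10"
      have "block_ok ip n''" using ** bs by (simp add: block_ok_def used_def)
      then have "invariant ip n'' g'"
        using inv fields ** consistent_flush[OF g] by (auto simp: invariant_def g'_def k_def)
      then show "safe_from t'' 9 n'' l ip (written g') (flushed g') (Suc 0)"
        using ** * t f by (intro cont) (simp_all add: fields)
    qed (use k1 bnd E_bounds * t in simp_all)
    then show "safe_from t' 65 n' l ip (written (flush (buf_size g) g)) (flushed g + buf_size g) (Suc 0)"
      by (simp add: fields)
  qed (use t in simp)
  then show ?thesis
    using z sc t by (subst unfold_at) (simp add: prog_nth)
qed

lemma safe_at_end:
  assumes inv: "invariant (length x) n g" and r: "represents n l g" and z: "n 12 > 0" and t: "t \<le> 95"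
  shows "safe_from t 9 n l (length x) (written g) (flushed g) (Suc 0)"
proof (rule safe_end_of_input[OF r refl z t])
  have g: "consistent g" using inv by (simp add: invariant_def)
  have e: "ancestors g = []" "ideal g = y" using inv by (simp_all add: invariant_def)
  have r': "represents (n(15 := 1)) l g" using r by (simp add: represents_def)
  have fl: "flushed g + buf_size g = length y" using g e by (simp add: consistent_def buf_ok_def)
  have hm: "holes g < M" using inv block_bounds(1)[of "length x" n] by (simp add: invariant_def)
  show "safe_from (Suc (Suc (Suc t))) 47 (n(15 := 1)) l (length x) (written g) (flushed g) (Suc 0)"
  proof (rule safe_flush[OF g invariant_room[OF inv] r'])
    fix n' :: "nat \<Rightarrow> nat" and t' :: nat
    let ?g = "clear_block (flush (buf_size g) g)"
    assume *: "represents n' l ?g" "\<forall>a\<in>control. n' a = (n(15 := 1)) a" "t' \<le> Suc (Suc (Suc t)) + 30"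
    have h: "holes ?g \<le> Suc (holes g)"
      by (simp add: clear_block_def flush_def store_hole_def split: option.split)
    have "safe_from (Suc t') 72 n' l (length x) (written ?g) (flushed g + buf_size g) (Suc 0)"
    proof (rule safe_second_pass[OF consistent_flush[OF g]])
      show "24 + 3 * holes ?g \<le> w" "length y < w"
        using h hm w length_y by linarith+
    qed (use e fl E_bounds * t in \<open>simp_all add: clear_block_def\<close>)
    then show "safe_from t' 65 n' l (length x) (written (flush (buf_size g) g)) (flushed g + buf_size g) (Suc 0)"
      using * t by (simp add: prog_nth unfold_at[where p=65] represents_def clear_block_def)
  qed (use t in simp)
qed (use E_bounds in simp_all)

lemma consistent_length: "consistent g \<Longrightarrow> flushed g + buf_size g = length (ideal g)"
  by (simp add: consistent_def buf_ok_def)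

lemmas ghost_ops = emit_def emit_hole_def push_def pop_def fill_candidate_def fill_hole_def

text \<open>The closed node was opened in this block, or its label is missing in the buffer, or it
  is missing on the output stream, or it is missing nowhere. \<open>cont\<close> keeps only what the
  four cases share.\<close>

lemma safe_pop_cases:
  assumes g: "consistent g" and rm: "room g" and ne: "ancestors g \<noteq> []" and b: "hd (ancestors g) = b"
    and r: "represents n l g" and l: "l 0 = InLetter (Closing b)" and t: "t \<le> 30"
    and cont: "\<And>n' l' t' g'. \<lbrakk>consistent g'; represents n' l' g'; \<forall>a\<in>control. n' a = n a;
      l' (Suc 0) = InLetter (Closing b); t' \<le> 50; ancestors g' = tl (ancestors g);
      right_done g' \<longleftrightarrow> snd b = RightChild; ideal g' = ideal g; holes g' = holes g;
      stack_size g' \<le> stack_size g; buf_size g' = buf_size g; written g' = written g;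
      flushed g' = flushed g\<rbrakk> \<Longrightarrow>
      safe_from t' 9 n' l' ip os op (Suc 0)"
  shows "safe_from t 30 n l ip os op (Suc 0)"
proof (cases "stack_size g > 0")
  case True
  show ?thesis
  proof (rule safe_pop_inside[OF r l t rm True ne])
    fix n' :: "nat \<Rightarrow> nat" and l' :: "nat \<Rightarrow> (('a \<times> side) tag, 'a tag) letter" and t' :: nat
    assume "represents n' l' (pop g)" "\<forall>a\<in>control. n' a = n a" "l' (Suc 0) = InLetter (Closing b)" "t' \<le> 50"
    then show "safe_from t' 9 n' l' ip os op (Suc 0)"
      by (rule cont[OF consistent_pop_inside[OF g True]]) (simp_all add: pop_def b)
  qed
next
  case False
  then have s: "stack_size g = 0" by simp
  show ?thesis
  proof (cases "candidate g")
    case (Some j)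
    have "j < buf_size g" using g Some by (simp add: consistent_def cand_ok_def)
    show ?thesis
    proof (rule safe_fill_candidate[OF r l t rm s Some \<open>j < buf_size g\<close>])
      fix n' :: "nat \<Rightarrow> nat" and l' :: "nat \<Rightarrow> (('a \<times> side) tag, 'a tag) letter" and t' :: nat
      let ?g = "fill_candidate (Closing (fst b)) j g"
      assume *: "represents n' l' ?g" "\<forall>a\<in>control. n' a = n a" "l' 0 = InLetter (Closing b)" "t' \<le> 40"
      show "safe_from t' 43 n' l' ip os op (Suc 0)"
      proof (rule safe_pop[OF *(1,3,4)])
        fix n'' :: "nat \<Rightarrow> nat" and l'' :: "nat \<Rightarrow> (('a \<times> side) tag, 'a tag) letter" and t'' :: nat
        assume "represents n'' l'' (pop ?g)" "\<forall>a\<in>control. n'' a = n' a"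
          "l'' (Suc 0) = InLetter (Closing b)" "t'' \<le> 50"
        then show "safe_from t'' 9 n'' l'' ip os op (Suc 0)"
          using consistent_pop_candidate[OF g s Some] *
          by (intro cont[of "pop ?g"]) (simp_all add: ghost_ops b)
      qed (use rm s ne in \<open>simp_all add: room_def ghost_ops\<close>)
    qed
  next
    case None
    show ?thesis
    proof (cases "unfilled g > 0 \<and> hole_depth g (unfilled g) = length (ancestors g)")
      case True
      then have u: "unfilled g > 0" "hole_depth g (unfilled g) = length (ancestors g)" by auto
      have "unfilled g \<in> {1..unfilled g}" using u by simp
      from unfilledD(1)[OF g this] have id: "hole_id g (unfilled g) < holes g" .
      have uh: "unfilled g \<le> holes g" using g by (simp add: consistent_def unfilled_ok_def)
      show ?thesis
      proof (rule safe_fill_hole[OF r l t rm s None u uh id])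
        fix n' :: "nat \<Rightarrow> nat" and l' :: "nat \<Rightarrow> (('a \<times> side) tag, 'a tag) letter" and t' :: nat
        let ?g = "fill_hole (Closing (fst b)) g"
        assume *: "represents n' l' ?g" "\<forall>a\<in>control. n' a = n a" "l' 0 = InLetter (Closing b)" "t' \<le> 40"
        show "safe_from t' 43 n' l' ip os op (Suc 0)"
        proof (rule safe_pop[OF *(1,3,4)])
          fix n'' :: "nat \<Rightarrow> nat" and l'' :: "nat \<Rightarrow> (('a \<times> side) tag, 'a tag) letter" and t'' :: nat
          assume "represents n'' l'' (pop ?g)" "\<forall>a\<in>control. n'' a = n' a"
            "l'' (Suc 0) = InLetter (Closing b)" "t'' \<le> 50"
          then show "safe_from t'' 9 n'' l'' ip os op (Suc 0)"
            using consistent_pop_hole[OF g s None u] *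
            by (intro cont[of "pop ?g"]) (simp_all add: ghost_ops b)
        qed (use rm s ne in \<open>simp_all add: room_def ghost_ops\<close>)
      qed
    next
      case False
      have c: "consistent (pop g)"
        by (rule consistent_pop_outside[OF g s None ne]) (use False in auto)
      show ?thesis
      proof (rule safe_pop_outside[OF r t s None ne])
        show "safe_from (Suc (Suc (Suc (Suc t)))) 43 n l ip os op (Suc 0)"
        proof (rule safe_pop[OF r l _ rm s ne])
          fix n' :: "nat \<Rightarrow> nat" and l' :: "nat \<Rightarrow> (('a \<times> side) tag, 'a tag) letter" and t' :: nat
          assume "represents n' l' (pop g)" "\<forall>a\<in>control. n' a = n a"
            "l' (Suc 0) = InLetter (Closing b)" "t' \<le> 50"
          then show "safe_from t' 9 n' l' ip os op (Suc 0)"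
            using c
            by (intro cont[of "pop g"]) (simp_all add: ghost_ops b)
        qed (use t in simp)
      qed (use False in simp)
    qed
  qed
qed

text \<open>The program does not store \<open>right_done\<close>: by \<open>pr\<close> it can be
  read off the previous letter, kept in letter cell 1.\<close>

lemma safe_letter:
  assumes inv: "invariant ip n g" and r: "represents n l g" and z: "n 12 > 0" and ip: "ip < length x"
    and pr: "right_done g = is_closing_right (l (Suc 0))" and t: "t \<le> 95"
    and cont: "\<And>n' l' t' g'. \<lbrakk>invariant (Suc ip) n' g'; represents n' l' g';
      right_done g' = is_closing_right (l' (Suc 0)); written g' = written g; flushed g' = flushed g;
      t' \<le> 50\<rbrakk> \<Longrightarrow>
      safe_from t' 9 n' l' (Suc ip) (written g) (flushed g) (Suc 0)"
  shows "safe_from t 9 n l ip (written g) (flushed g) (Suc 0)"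
proof -
  let ?n = "n(12 := n 12 - 1)" and ?l = "l(0 := InLetter (x ! ip))" and ?r = "drop (Suc ip) x"
  have g: "consistent g" and bk: "block_ok ip n" using inv by (simp_all add: invariant_def)
  have rm: "room g" by (rule invariant_room[OF inv])
  have dr: "drop ip x = x ! ip # ?r" using ip by (simp add: Cons_nth_drop_Suc)
  have m: "matched (ancestors g) (right_done g) (x ! ip # ?r)"
    and e: "ideal g @ emits (ancestors g) (right_done g) (x ! ip # ?r) = y"
    using inv unfolding invariant_def dr by simp_all
  have us: "used ?n = Suc (used n)"
    using bk z by (auto simp: block_ok_def used_def)
  have bk': "block_ok (Suc ip) ?n"
    using bk us z by (auto simp: block_ok_def)
  note bb = block_bounds[OF bk', simplified]
  have "n 12 \<le> w" using bk bb(2) w ip by (auto simp: block_ok_def)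
  \<comment> \<open>Between the two tags emitted for one letter the ghost state does not satisfy
    \<open>invariant\<close>, so its room is derived from the growth per letter.\<close>
  have room': "room g'" if "flushed g' + buf_size g' = length (ideal g')" "holes g' = holes g"
    "stack_size g' \<le> Suc (stack_size g)" "buf_size g' \<le> buf_size g + 2"
    "length (ancestors g') \<le> Suc (length (ancestors g))" "length (ideal g') \<le> length y" for g'
  proof (rule roomI)
    show "holes g' \<le> M" "stack_size g' \<le> M * floorlog 2 M" "buf_size g' \<le> 2 * (M * floorlog 2 M)"
      "length (ancestors g') \<le> length x"
      using that inv bb ip us ip unfolding invariant_def by (auto simp: used_def)
  qed (use that length_y in simp_all)
  have finish: "safe_from t' 9 n' l' (Suc ip) (written g) (flushed g) (Suc 0)"
    if "consistent g'" "represents n' l' g'" "\<forall>a\<in>control. n' a = ?n a"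
      "right_done g' = is_closing_right (l' (Suc 0))" "t' \<le> 50" "holes g' = holes g"
      "stack_size g' \<le> Suc (stack_size g)" "buf_size g' \<le> buf_size g + 2"
      "length (ancestors g') \<le> Suc (length (ancestors g))"
      "matched (ancestors g') (right_done g') ?r"
      "ideal g' @ emits (ancestors g') (right_done g') ?r = y"
      "written g' = written g" "flushed g' = flushed g" for n' l' g' t'
  proof (rule cont)
    have "block_ok (Suc ip) n'" using bk' that(3) by (rule block_ok_cong)
    moreover have "used n' = Suc (used n)" using us that(3) by (simp add: used_def)
    ultimately show "invariant (Suc ip) n' g'"
      using that inv ip unfolding invariant_def by (auto simp: fun_upd_def)
  qed (use that in simp_all)
  show ?thesis
  proof (rule safe_read[OF r ip z \<open>n 12 \<le> w\<close> t E_bounds(1,2)])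
    assume r1: "represents ?n ?l g"
    show "safe_from (Suc 0) 12 ?n ?l (Suc ip) (written g) (flushed g) (Suc 0)"
    proof (cases "x ! ip")
      case (Opening b)
      have l0: "?l 0 = InLetter (Opening b)" using Opening by simp
      have f: "\<not> right_done g" and ne: "snd b = RightChild \<Longrightarrow> ancestors g \<noteq> []"
        and m': "matched (b # ancestors g) False ?r"
        using m Opening by simp_all
      \<comment> \<open>The common tail of the three ways to open a node. Consistency is required of
        \<open>push b h\<close> only, since \<open>h\<close> may carry a fresh hole whose right
        child is not pushed yet.\<close>
      have open_node: "safe_from t' 20 n' l' (Suc ip) (written g) (flushed g) (Suc 0)"
        if "represents n' l' h" "\<forall>a\<in>control. n' a = ?n a" "l' 0 = InLetter (Opening b)" "t' \<le> 20"
          "consistent (push b h)" "room h" "holes h = holes g" "stack_size h = stack_size g"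
          "buf_size h \<le> Suc (buf_size g)" "ancestors h = ancestors g"
          "ideal h @ Opening (fst b) # emits (b # ancestors g) False ?r = y"
          "written h = written g" "flushed h = flushed g"
        for n' l' h t'
      proof (rule safe_opening[OF that(1,3,4,6)])
        fix n'' :: "nat \<Rightarrow> nat" and l'' :: "nat \<Rightarrow> (('a \<times> side) tag, 'a tag) letter" and t'' :: nat
        assume *: "represents n'' l'' (emit (Opening (fst b)) (push b h))"
          "\<forall>a\<in>control. n'' a = n' a" "l'' (Suc 0) = InLetter (Opening b)" "t'' \<le> 50"
        show "safe_from t'' 9 n'' l'' (Suc ip) (written g) (flushed g) (Suc 0)"
          by (rule finish[OF consistent_emit[OF that(5)] *(1)])
            (use * that m' in \<open>simp_all add: ghost_ops\<close>)
      qed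
      show ?thesis
      proof (cases "snd b")
        case LeftChild
        show ?thesis
          by (rule safe_opening_left[OF l0 LeftChild _ open_node[OF r1 _ l0]])
            (use consistent_push[OF g f] rm e Opening LeftChild f in simp_all)
      next
        case RightChild
        have an: "ancestors g \<noteq> []" by (rule ne[OF RightChild])
        let ?z = "Closing (fst (hd (ancestors g)))"
        have e': "ideal g @ ?z # Opening (fst b) # emits (b # ancestors g) False ?r = y"
          using e Opening RightChild by simp
        show ?thesis
        proof (cases "stack_size g > 0")
          case True
          have top: "stack_cell g (stack_size g) = InLetter (Opening (hd (ancestors g)))"
            using g True an by (auto simp: consistent_def stack_ok_def hd_conv_nth)
          show ?thesis
          proof (rule safe_opening_right[OF r1 True top l0 RightChild _ rm])
            fix n' :: "nat \<Rightarrow> nat" and l' :: "nat \<Rightarrow> (('a \<times> side) tag, 'a tag) letter" and t' :: nat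
            assume *: "represents n' l' (emit ?z g)" "\<forall>a\<in>control. n' a = ?n a"
              "l' 0 = InLetter (Opening b)" "t' \<le> 20"
            have c: "consistent (emit ?z g)" by (rule consistent_emit[OF g])
            have "room (emit ?z g)"
              using consistent_length[OF c] e' by (intro room') (auto simp: ghost_ops)
            then show "safe_from t' 20 n' l' (Suc ip) (written g) (flushed g) (Suc 0)"
              using consistent_push[OF c] f e'
              by (intro open_node[OF *]) (simp_all add: ghost_ops)
          qed simp
        next
          case False
          then have s: "stack_size g = 0" by simp
          show ?thesis
          proof (rule safe_opening_right_outside[OF r1 s l0 RightChild _ rm])
            fix n' :: "nat \<Rightarrow> nat" and l' :: "nat \<Rightarrow> (('a \<times> side) tag, 'a tag) letter" and t' :: nat
            assume *: "represents n' l' (emit_hole ?z g)" "\<forall>a\<in>control. n' a = ?n a"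
              "l' 0 = InLetter (Opening b)" "t' \<le> 20"
            have "room (emit_hole ?z g)"
              using consistent_length[OF g] e' by (intro room') (auto simp: ghost_ops)
            then show "safe_from t' 20 n' l' (Suc ip) (written g) (flushed g) (Suc 0)"
              using consistent_emit_hole_push[OF g f s an RightChild] e'
              by (intro open_node[OF *]) (simp_all add: ghost_ops)
          qed simp
        qed
      qed
    next
      case (Closing b)
      have l0: "?l 0 = InLetter (Closing b)" using Closing by simp
      have ne: "ancestors g \<noteq> []" and b: "hd (ancestors g) = b"
        and m': "matched (tl (ancestors g)) (snd b = RightChild) ?r"
        using m Closing by simp_all
      have popping: "safe_from t' 30 n' l' (Suc ip) (written g) (flushed g) (Suc 0)"
        if "represents n' l' h" "\<forall>a\<in>control. n' a = ?n a" "l' 0 = InLetter (Closing b)" "t' \<le> 30"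
          "consistent h" "room h" "holes h = holes g" "stack_size h = stack_size g"
          "buf_size h \<le> Suc (buf_size g)" "ancestors h = ancestors g"
          "ideal h @ emits (tl (ancestors g)) (snd b = RightChild) ?r = y"
          "written h = written g" "flushed h = flushed g"
        for n' l' h t'
      proof (rule safe_pop_cases[OF that(5,6) _ _ that(1,3,4)])
        fix n'' :: "nat \<Rightarrow> nat" and l'' :: "nat \<Rightarrow> (('a \<times> side) tag, 'a tag) letter" and t'' :: nat and g' :: "'a ghost"
        assume "consistent g'" "represents n'' l'' g'" "\<forall>a\<in>control. n'' a = n' a"
          "l'' (Suc 0) = InLetter (Closing b)" "t'' \<le> 50" "ancestors g' = tl (ancestors h)"
          "right_done g' \<longleftrightarrow> snd b = RightChild" "ideal g' = ideal h" "holes g' = holes h"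
          "stack_size g' \<le> stack_size h" "buf_size g' = buf_size h" "written g' = written h"
          "flushed g' = flushed h"
        then show "safe_from t'' 9 n'' l'' (Suc ip) (written g) (flushed g) (Suc 0)"
          using that m' by (intro finish[of g' n'' l'']) simp_all
      qed (use that ne b in simp_all)
      show ?thesis
      proof (cases "right_done g")
        case True
        show ?thesis
          by (rule safe_closing_right_done[OF l0 _ _ popping[OF r1 _ l0]])
            (use True pr g rm e Closing in simp_all)
      next
        case False
        show ?thesis
        proof (rule safe_closing_emit[OF r1 l0 _ _ rm])
          fix n' :: "nat \<Rightarrow> nat" and l' :: "nat \<Rightarrow> (('a \<times> side) tag, 'a tag) letter" and t' :: nat
          assume *: "represents n' l' (emit (Closing (fst b)) g)" "\<forall>a\<in>control. n' a = ?n a"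
            "l' 0 = InLetter (Closing b)" "t' \<le> 20"
          have c: "consistent (emit (Closing (fst b)) g)" by (rule consistent_emit[OF g])
          have e': "ideal g @ Closing (fst b) # emits (tl (ancestors g)) (snd b = RightChild) ?r = y"
            using e Closing False by simp
          have "room (emit (Closing (fst b)) g)"
            using consistent_length[OF c] e' by (intro room') (auto simp: ghost_ops)
          then show "safe_from t' 30 n' l' (Suc ip) (written g) (flushed g) (Suc 0)"
            using c e' by (intro popping[OF *(1-3)]) (use * in \<open>simp_all add: ghost_ops\<close>)
        qed (use False pr in simp_all)
      qed
    qed
  qed
qed

text \<open>A letter leaves at most 50 steps on the clock at the head of the loop, and a block end
  raises this to at most 95. The case distinction on \<open>n 12\<close> ensures that the raise
  happens at most once between two letters.\<close>

lemma safe_main_loop: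
  "\<lbrakk>invariant ip n g; represents n l g; right_done g = is_closing_right (l (Suc 0));
     t \<le> (if n 12 = 0 then 50 else 95)\<rbrakk> \<Longrightarrow>
   safe_from t 9 n l ip (written g) (flushed g) (Suc 0)"
proof (induction "length x - ip" arbitrary: ip n g l t rule: less_induct)
  case less
  \<comment> \<open>A block end consumes no letter, so the induction hypothesis does not apply after
    it. The case of a block with letters left is therefore proved first, for arbitrary number cells,
    ghost state and clock.\<close>
  have nonzero: "safe_from t 9 n l ip (written g) (flushed g) (Suc 0)"
    if inv: "invariant ip n g" and r: "represents n l g" and pr: "right_done g = is_closing_right (l (Suc 0))"
      and t: "t \<le> 95" and z: "n 12 > 0" for n g t
  proof (cases "ip < length x")
    case True
    show ?thesis
    proof (rule safe_letter[OF inv r z True pr t])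
      fix n' :: "nat \<Rightarrow> nat" and l' :: "nat \<Rightarrow> (('a \<times> side) tag, 'a tag) letter" and t' :: nat and g' :: "'a ghost"
      assume "invariant (Suc ip) n' g'" "represents n' l' g'" "right_done g' = is_closing_right (l' (Suc 0))"
        "written g' = written g" "flushed g' = flushed g" "t' \<le> 50"
      then show "safe_from t' 9 n' l' (Suc ip) (written g) (flushed g) (Suc 0)"
        using less.hyps[of "Suc ip" n' g' l' t'] True by simp
    qed
  next
    case False
    then have "ip = length x" using inv by (simp add: invariant_def)
    then show ?thesis using safe_at_end[of n g l t] inv r z t by simp
  qed
  show ?case
  proof (cases "n 12 = 0")
    case False
    then show ?thesis using nonzero less.prems by simp
  next
    case True
    show ?thesis
      by (rule safe_block_end[OF less.prems(1,2) True]) (use True less.prems nonzero in auto)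
  qed
qed

definition initial_ghost :: "'a ghost" where
  "initial_ghost = \<lparr>ancestors = [], right_done = False, ideal = [], stack_size = 0,
     stack_cell = (\<lambda>_. Blank), buf_size = 0, buf_cell = (\<lambda>_. Blank), candidate = None, flushed = 0,
     written = (\<lambda>_. None), holes = 0, hole_pos = (\<lambda>_. 0), label_cell = (\<lambda>_. Blank), unfilled = 0,
     hole_depth = (\<lambda>_. 0), hole_id = (\<lambda>_. 0)\<rparr>"

lemma safe_program: "safe_from 0 0 (\<lambda>_. 0) (\<lambda>_. Blank) 0 (\<lambda>_. None) 0 (Suc 0)"
proof -
  let ?n = "(\<lambda>_. 0 :: nat)(1 := 1, 2 := 3, 4 := 4, 7 := 18, 8 := 20, 9 := 1, 10 := 1, 11 := 2, 12 := 1)"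
  have f1: "floorlog 2 (Suc 0) = Suc 0" by (simp add: floorlog_def)
  have "block_ok 0 ?n" using f1 by (simp add: block_ok_def used_def block_sum_def)
  then have "invariant 0 ?n initial_ghost"
    using matched_input emitted
    by (auto simp: invariant_def initial_ghost_def consistent_defs)
  moreover have "represents ?n (\<lambda>_. Blank) initial_ghost"
    by (simp add: represents_def initial_ghost_def)
  ultimately have "safe_from 9 9 ?n (\<lambda>_. Blank) 0 (written initial_ghost) (flushed initial_ghost) (Suc 0)"
    by (rule safe_main_loop) (simp_all add: initial_ghost_def)
  then have *: "safe_from 9 9
      ((\<lambda>_. 0)(Suc 0 := Suc 0, 2 := 3, 4 := 4, 7 := 18, 8 := 20, 9 := Suc 0, 10 := Suc 0, 11 := 2, 12 := Suc 0))
      (\<lambda>_. Blank) 0 (\<lambda>_. None) 0 (Suc 0)"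
    by (simp add: initial_ghost_def)
  have 1: "(prog :: (('a \<times> side) tag, 'a tag) program) ! Suc 0 = SetConst (Dir 2) 3"
    by (simp add: prog_def)
  show ?thesis
    using * E_bounds
    by (simp add: 1 prog_nth numeral_2_eq_2[symmetric] unfold_at[where p=0] unfold_at[where p="Suc 0"]
      unfold_at[where p=2] unfold_at[where p=3] unfold_at[where p=4] unfold_at[where p=5] unfold_at[where p=6]
      unfold_at[where p=7] unfold_at[where p=8])
qed

end

section \<open>Resource bounds\<close>

lemma floorlog_pos: "k > 0 \<Longrightarrow> floorlog 2 k > 0"
  using floorlog_eq_zero_iff[of 2 k] by simp

lemma le_Suc_block_sum: "k \<le> Suc (block_sum k)"
proof (induction k)
  case (Suc k)
  show ?case
  proof (cases "k = 0")
    case False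
    then have "1 \<le> k * floorlog 2 k" using floorlog_pos[of k] by simp
    then show ?thesis using Suc unfolding block_sum_Suc by linarith
  qed simp
qed simp

text \<open>\<open>2 * N\<close> is the length of the input for a tree with \<open>N\<close>
  nodes.\<close>

definition max_block :: "nat \<Rightarrow> nat" where
  "max_block N = Max {k. block_sum k \<le> 2 * N}"

lemma finite_blocks: "finite {k. block_sum k \<le> 2 * N}"
proof (rule finite_subset)
  show "{k. block_sum k \<le> 2 * N} \<subseteq> {..Suc (2 * N)}"
    using le_Suc_block_sum by (auto intro: le_trans)
qed simp

lemma le_max_block: "block_sum k \<le> 2 * N \<Longrightarrow> k \<le> max_block N"
  unfolding max_block_def by (rule Max_ge[OF finite_blocks]) simp

lemma max_block_pos: "1 \<le> max_block N"
  by (rule le_max_block) (simp add: block_sum_def floorlog_def)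

lemma block_sum_max_block: "block_sum (max_block N) \<le> 2 * N"
proof -
  have "0 \<in> {k. block_sum k \<le> 2 * N}" by (simp add: block_sum_def)
  then show ?thesis
    using Max_in[OF finite_blocks, of N] unfolding max_block_def by blast
qed

text \<open>The upper half of the blocks contributes about half of the total.\<close>

lemma block_sum_ge:
  assumes "m \<ge> 2"
  shows "m * m * floorlog 2 m \<le> 12 * block_sum m"
proof -
  define h where "h = m div 2"
  define L where "L = floorlog 2 m"
  have L2: "2 \<le> L" unfolding L_def using assms by (intro floorlog_geI) auto
  define c where "c = L - 2"
  have c: "L = Suc (Suc c)" using L2 by (simp add: c_def)
  have "2 ^ Suc c \<le> m" using floorlog_bounds[of m 2] assms by (simp add: L_def[symmetric] c)
  then have "2 ^ c \<le> h" by (simp add: h_def)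
  then have "Suc c \<le> floorlog 2 h" by (intro floorlog_geI) simp_all
  \<comment> \<open>Halving \<open>m\<close> costs one binary digit, which is at most half of them
    as \<open>2 \<le> L\<close>.\<close>
  then have l: "L \<le> 2 * floorlog 2 h" using c by linarith
  have h: "m \<le> 2 * (m - h)" "m \<le> 3 * h" using assms unfolding h_def by linarith+
  \<comment> \<open>The losses 2, 3 and 2 multiply to 12; the 3 is attained at
    \<open>m = 3\<close>.\<close>
  have "m * m * L \<le> (2 * (m - h)) * (3 * h) * (2 * floorlog 2 h)"
    by (intro mult_le_mono h l)
  also have "\<dots> = 12 * (\<Sum>i\<in>{h..<m}. h * floorlog 2 h)"
    by simp
  also have "(\<Sum>i\<in>{h..<m}. h * floorlog 2 h) \<le> (\<Sum>i\<in>{h..<m}. i * floorlog 2 i)"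
    by (intro sum_mono mult_le_mono floorlog_mono) auto
  also have "(\<Sum>i\<in>{h..<m}. i * floorlog 2 i) \<le> block_sum m"
    unfolding block_sum_def by (intro sum_mono2) auto
  finally show ?thesis by (simp add: L_def)
qed

lemma max_block_bound:
  assumes "N > 0"
  shows "max_block N * max_block N * floorlog 2 (max_block N) \<le> 24 * N"
proof (cases "max_block N \<ge> 2")
  case True
  then show ?thesis using block_sum_ge[OF True] block_sum_max_block[of N] by simp
next
  case False
  then have "max_block N = 1" using max_block_pos[of N] by simp
  then show ?thesis using assms by (simp add: floorlog_def)
qed

lemma max_block_cell_bound:
  assumes "N > 0"
  shows "max_block N * floorlog 2 (max_block N) \<le> 24 * N" "max_block N \<le> 24 * N"
proof -
  have 1: "1 \<le> floorlog 2 (max_block N)" "1 \<le> max_block N"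
    using floorlog_pos[of "max_block N"] max_block_pos[of N] by auto
  then have "1 * max_block N * floorlog 2 (max_block N) \<le> 24 * N"
    using mult_le_mono[OF mult_le_mono[OF 1(2) le_refl] le_refl] max_block_bound[OF assms] le_trans by blast
  then show z: "max_block N * floorlog 2 (max_block N) \<le> 24 * N" by simp
  have "max_block N * 1 \<le> max_block N * floorlog 2 (max_block N)"
    by (rule mult_le_mono[OF le_refl 1(1)])
  with z show "max_block N \<le> 24 * N" by linarith
qed

text \<open>\<open>number_bound\<close> and \<open>space_bound\<close> come from the least
  admissible values of the locale parameters \<open>w\<close>, \<open>E1\<close> and
  \<open>E2\<close> for an input of length \<open>2 * N\<close>.\<close>

definition number_bound :: "nat \<Rightarrow> nat" where
  "number_bound N = 40 + 6 * (max_block N * floorlog 2 (max_block N)) + 6 * max_block N + 12 * N"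

definition space_bound :: "nat \<Rightarrow> nat" where
  "space_bound N = (30 + 6 * (max_block N * floorlog 2 (max_block N)) + 3 * max_block N) +
     (24 + 3 * max_block N) * Suc (floorlog 2 (number_bound N))"

text \<open>Both terms in \<open>max_block N\<close> are at most \<open>6 * 24 * N\<close>, and 40 +
  144 + 144 + 12 = 340.\<close>

lemma number_bound_le: "N > 0 \<Longrightarrow> number_bound N \<le> 340 * N"
  using max_block_cell_bound[of N] unfolding number_bound_def by linarith

lemma number_bound_bigo: "(\<lambda>N. real (number_bound N)) \<in> O(\<lambda>N. real N)"
proof (rule bigoI)
  show "\<forall>\<^sub>F N in sequentially. norm (real (number_bound N)) \<le> 340 * norm (real N)"
    using eventually_gt_at_top[of 0]
  proof eventually_elim
    case (elim N)
    then have "real (number_bound N) \<le> real (340 * N)"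
      using number_bound_le by (simp only: of_nat_le_iff)
    then show ?case by simp
  qed
qed

section \<open>Asymptotics of the space bound\<close>

lemma floorlog_le_log:
  assumes "k > 0"
  shows "real (floorlog 2 k) \<le> log 2 (real k) + 1"
proof -
  have "0 \<le> log 2 (real k)" using assms by simp
  then show ?thesis using assms by (simp add: floorlog_def)
qed

text \<open>For \<open>N \<ge> 2\<close> the logarithm is at least 1 and absorbs the additive
  constants.\<close>

lemma floorlog_le_mult_log:
  assumes "N \<ge> 2" "0 < k" "k \<le> 2 ^ c * N"
  shows "real (floorlog 2 k) \<le> (real c + 2) * log 2 (real N)"
proof -
  have L: "1 \<le> log 2 (real N)" using assms(1) by simp
  have "real k \<le> real (2 ^ c * N)" using assms(3) by (simp only: of_nat_le_iff)
  then have "log 2 (real k) \<le> log 2 (2 ^ c * real N)"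
    using assms(2) by (intro log_mono) simp_all
  also have "\<dots> = real c + log 2 (real N)"
    using assms by (simp add: log_mult log_nat_power)
  finally have "real (floorlog 2 k) \<le> real c + log 2 (real N) + 1"
    using floorlog_le_log[OF assms(2)] by linarith
  also have "\<dots> \<le> real c * log 2 (real N) + log 2 (real N) + log 2 (real N)"
    using L mult_left_mono[OF L, of "real c"] by simp
  finally show ?thesis by (simp add: algebra_simps)
qed

text \<open>Either \<open>m\<close> is at least the fourth root of \<open>N\<close>, and then its binary length is of the order of
  \<open>log 2 N\<close>, or \<open>m\<close> is so small that a factor \<open>log 2 N\<close> does not matter.\<close>

lemma square_mult_log_le:
  assumes N: "N \<ge> 2" and m: "m > 0" "m * m * floorlog 2 m \<le> 24 * N"
  shows "real m * real m * log 2 (real N) \<le> 96 * real N"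
proof (cases "log 2 (real N) \<le> 4 * real (floorlog 2 m)")
  case True
  have "real m * real m * log 2 (real N) \<le> real m * real m * (4 * real (floorlog 2 m))"
    by (intro mult_left_mono True) simp
  also have "\<dots> = 4 * real (m * m * floorlog 2 m)" by simp
  also have "\<dots> \<le> 4 * real (24 * N)" using of_nat_mono[OF m(2), where 'a = real] by linarith
  finally show ?thesis by simp
next
  case False
  let ?l = "floorlog 2 m"
  have "real m < 2 ^ ?l" using of_nat_less_iff[of m "2 ^ ?l", where 'a = real] floorlog_bounds[of m 2] m by simp
  then have "real m ^ 4 \<le> (2 ^ ?l) ^ 4" by (intro power_mono) auto
  also have "\<dots> = 2 powr (4 * real ?l)"
    by (simp add: powr_realpow[symmetric] powr_powr flip: power_mult)
      (simp add: mult.commute)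
  also have "\<dots> \<le> 2 powr (log 2 (real N))" using False by (intro powr_mono) auto
  also have "\<dots> = real N" using N by simp
  finally have "(real m * real m)\<^sup>2 \<le> real N" by (simp add: power2_eq_square power4_eq_xxxx mult.assoc)
  then have a: "real m * real m \<le> sqrt (real N)" by (intro real_le_rsqrt)
  have "log 2 (real N) = 2 * log 2 (sqrt (real N))"
    using N by (simp add: log_def ln_sqrt)
  also have "log 2 (sqrt (real N)) \<le> 2 * sqrt (real N)"
  proof -
    have half: "1 / 2 \<le> ln (2 :: real)" using exp_half_le2 by (subst ln_ge_iff) simp_all
    have "1 \<le> sqrt (real N)" using N by simp
    then have "ln (sqrt (real N)) \<le> sqrt (real N) - 1" by (intro ln_le_minus_one) simp
    also have "\<dots> \<le> 2 * sqrt (real N) * (1 / 2)" by simp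
    also have "\<dots> \<le> 2 * sqrt (real N) * ln 2"
      using half by (intro mult_left_mono) simp_all
    finally show ?thesis by (simp add: log_def divide_le_eq)
  qed
  finally have b: "log 2 (real N) \<le> 4 * sqrt (real N)" by simp
  have "real m * real m * log 2 (real N) \<le> sqrt (real N) * (4 * sqrt (real N))"
    using a b N by (intro mult_mono) auto
  also have "\<dots> = 4 * real N" by simp
  finally show ?thesis by simp
qed

text \<open>Up to constants, a block has \<open>m log m\<close> letters and the table takes
  \<open>m log N\<close> bits. Their squares are \<open>m^2 log m\<close> times \<open>log m\<close>
  and \<open>m^2 log N\<close> times \<open>log N\<close>, and the bounds on \<open>m\<close> make
  both of order \<open>N log N\<close>; hence the comparison of squares with multiples of
  \<open>s\<close>.\<close>

lemma space_bound_le: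
  assumes N: "N \<ge> 2"
  shows "real (space_bound N) \<le> 4000 * sqrt (real N * log 2 (real N))"
proof -
  define m where "m = max_block N"
  define z where "z = real m * real (floorlog 2 m)"
  define L where "L = log 2 (real N)"
  define s where "s = sqrt (real N * L)"
  define P where "P = real N * L"
  have N0: "N > 0" using N by simp
  have L: "1 \<le> L" using N by (simp add: L_def)
  have P: "0 \<le> P" using L by (simp add: P_def)
  have s0: "0 \<le> s" and ss: "s * s = P" using P by (simp_all add: s_def P_def)
  have m1: "1 \<le> m" using max_block_pos by (simp add: m_def)
  have b: "m * m * floorlog 2 m \<le> 24 * N" using max_block_bound[OF N0] by (simp add: m_def)
  \<comment> \<open>The 5 comes from \<open>m \<le> 24 * N\<close> and
    \<open>24 \<le> 2 ^ 5\<close>.\<close>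
  have "real (floorlog 2 m) \<le> (real 5 + 2) * L"
    unfolding L_def using N m1 max_block_cell_bound(2)[OF N0] by (intro floorlog_le_mult_log) (auto simp: m_def)
  then have "real (m * m * floorlog 2 m) * real (floorlog 2 m) \<le> (24 * real N) * (7 * L)"
    using of_nat_mono[OF b, where 'a = real] by (intro mult_mono) simp_all
  then have "z * z \<le> (24 * real N) * (7 * L)"
    by (simp add: z_def mult_ac)
  also have "\<dots> = 168 * P" by (simp add: P_def)
  also have "\<dots> \<le> 169 * P" using P by simp
  also have "\<dots> = (13 * s) * (13 * s)" by (simp add: ss)
  finally have "z\<^sup>2 \<le> (13 * s)\<^sup>2" by (simp only: power2_eq_square)
  then have zs: "z \<le> 13 * s"
    by (rule power2_le_imp_le) (use s0 in simp)
  have "real m * real m * L \<le> 96 * real N"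
    unfolding L_def using square_mult_log_le[OF N _ b] m1 by simp
  then have "(real m * real m * L) * L \<le> (96 * real N) * L"
    by (rule mult_right_mono) (use L in simp)
  also have "\<dots> = 96 * P" by (simp add: P_def)
  also have "\<dots> \<le> 100 * P" using P by simp
  also have "\<dots> = (10 * s)\<^sup>2" by (simp add: power2_eq_square ss)
  also have "real m * real m * L * L = (real m * L)\<^sup>2" by (simp add: power2_eq_square)
  finally have ms: "real m * L \<le> 10 * s"
    by (rule power2_le_imp_le) (use s0 in simp)
  have nb: "number_bound N > 0" by (simp add: number_bound_def)
  \<comment> \<open>The 9 comes from \<open>340 \<le> 2 ^ 9\<close>.\<close>
  have "real (floorlog 2 (number_bound N)) \<le> (real 9 + 2) * L"
    unfolding L_def using number_bound_le[OF N0] N nb by (intro floorlog_le_mult_log) auto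
  then have f: "real (Suc (floorlog 2 (number_bound N))) \<le> 12 * L" using L by simp
  have mL: "1 \<le> real m * L" "real m \<le> real m * L"
    using m1 L mult_mono[of 1 "real m" 1 L] mult_left_mono[of 1 L "real m"] by auto
  have "real (space_bound N) = 30 + 6 * z + 3 * real m + (24 + 3 * real m) * real (Suc (floorlog 2 (number_bound N)))"
    by (simp add: space_bound_def m_def z_def algebra_simps)
  also have "\<dots> \<le> 30 + 6 * z + 3 * real m + (27 * real m) * (12 * L)"
    using m1 f by (intro add_left_mono mult_mono) auto
  \<comment> \<open>Since \<open>1 \<le> real m * L\<close> and
    \<open>real m * L \<le> 10 * s\<close>, the summands are at most 300, 78, 30 and 3240 times
    \<open>s\<close>.\<close>
  also have "\<dots> \<le> 4000 * s"
    using mL zs ms by simp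
  finally show ?thesis by (simp add: s_def L_def)
qed

lemma space_bound_bigo:
  "(\<lambda>N. real (space_bound N)) \<in> O(\<lambda>N. sqrt (real N * log 2 (real N)))"
proof (rule bigoI)
  show "\<forall>\<^sub>F N in sequentially. norm (real (space_bound N)) \<le> 4000 * norm (sqrt (real N * log 2 (real N)))"
    using eventually_ge_at_top[of 2]
  proof eventually_elim
    case (elim N)
    then have "0 \<le> sqrt (real N * log 2 (real N))" by simp
    then show ?case using space_bound_le[OF elim] by simp
  qed
qed

lemma prog_correct:
  fixes t :: "'a utree"
  defines "N \<equiv> num_nodes t"
  shows "outputs_in_passes prog (xml_bin (fcns t)) 1 2 (xml t)"
    "uses_space prog (xml_bin (fcns t)) (space_bound N)"
    "has_processing_time prog (xml_bin (fcns t)) 200"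
    "has_number_bound prog (xml_bin (fcns t)) (number_bound N)"
proof -
  let ?z = "max_block N * floorlog 2 (max_block N)"
  interpret transcoder "xml_bin (fcns t)" "xml t" "max_block N" "24 + 3 * max_block N"
    "30 + 6 * ?z + 3 * max_block N" "number_bound N"
  proof
    show "k \<le> max_block N" if "(\<Sum>i<k. i * floorlog 2 i) \<le> length (xml_bin (fcns t))" for k
      using that by (intro le_max_block) (simp add: block_sum_def length_xml_bin_fcns N_def)
  qed (simp_all add: matched_fcns emits_fcns length_xml length_xml_bin_fcns number_bound_def N_def)
  note * = safe_initial[OF safe_program[folded One_nat_def]]
  show "outputs_in_passes prog (xml_bin (fcns t)) 1 2 (xml t)"
    "uses_space prog (xml_bin (fcns t)) (space_bound N)"
    "has_processing_time prog (xml_bin (fcns t)) 200"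
    "has_number_bound prog (xml_bin (fcns t)) (number_bound N)"
    using * by (simp_all add: space_bound_def)
qed

theorem theorem6:
  shows "\<exists>(A :: (('a::finite \<times> side) tag, 'a tag) program)
      (S :: nat \<Rightarrow> nat) (T :: nat \<Rightarrow> nat) (W :: nat \<Rightarrow> nat).
    (\<lambda>N. real (S N)) \<in> O(\<lambda>N. sqrt (real N * log 2 (real N))) \<and>
    (\<lambda>N. real (T N)) \<in> O(\<lambda>N. 1) \<and>
    (\<lambda>N. real (W N)) \<in> O(\<lambda>N. real N) \<and>
    (\<forall>t :: 'a utree.
       outputs_in_passes A (xml_bin (fcns t)) 1 2 (xml t) \<and>
       uses_space A (xml_bin (fcns t)) (S (num_nodes t)) \<and>
       has_processing_time A (xml_bin (fcns t)) (T (num_nodes t)) \<and>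
       has_number_bound A (xml_bin (fcns t)) (W (num_nodes t)))"
  using space_bound_bigo number_bound_bigo prog_correct
  by (intro exI[of _ prog] exI[of _ space_bound] exI[of _ "\<lambda>_. 200"] exI[of _ number_bound]) auto

end
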